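(* There exists no pair $(R,r)$ consisting of a rational function $R$ on $\mathbb C^8$ and a symmetric rational function $r$ on $\mathbb C^3$ with the property that every quadratic vector field with non-degenerate singularities satisfies the relation $$R(t_1,\dots,t_4;d_1,\dots,d_4)=r(\lambda_1,\lambda_2,\lambda_3),$$ except for those that can be derived from the relations (EJ1), (EJ2), (BB), (CS). In other words, if $R$ is a rational function on $\mathbb C^8$ and $r$ is a symmetric rational function on $\mathbb C^3$ such that $R(t;d)=r(\lambda)$ holds for the extended spectra of every quadratic vector field with non-degenerate singularities, then the relation $R(t;d)=r(\lambda)$ can be derived from (EJ1), (EJ2), (BB), (CS).
   Context: A quadratic vector field on $\mathbb C^2$ is $v=P\,\partial_x+Q\,\partial_y$ with $P,Q\in\mathbb C[x,y]$ of degree at most $2$; let $P_2,Q_2$ be the homogeneous parts of degree $2$. The quadratic vector fields considered here (those with non-degenerate singularities) are the ones having exactly $4$ isolated singularities $p_1,\dots,p_4\in\mathbb C^2$ and such that the extension $\mathcal F_v$ of the foliation to $\mathbb P^2$ has an invariant line at infinity $\mathcal L=\mathbb P^2\setminus\mathbb C^2$ carrying exactly $3$ singular points (i.e. $yP_2-xQ_2$ is a nonzero cubic form with three distinct zeros in $\mathbb P^1$). Both the finite and the infinite singularities are assumed to be enumerated. Extended spectra: $t_k=\operatorname{tr}Dv(p_k)$, $d_k=\det Dv(p_k)$ for $k=1,\dots,4$, where $Dv$ is the Jacobian matrix of $(P,Q)$, together with the characteristic numbers at infinity $\lambda_1,\lambda_2,\lambda_3$. The latter are the Camacho-Sad indices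 of $\mathcal F_v$ along $\mathcal L$: in the coordinates $z=1/x$, $w=y/x$ the foliation is given by $\frac{dz}{dw}=z\sum_{j=1}^3\frac{\lambda_j}{w-w_j}+O(z^2)$, where $w_j$ are the singular points on $\mathcal L=\{z=0\}$; if a singular point at infinity lies in the direction $x=0$, one first applies a linear change of coordinates, on which the $\lambda_j$ do not depend. For such $v$ all $d_k$ and $\lambda_j$ are nonzero. The four classical relations are (EJ1) $\sum_{k=1}^4 \frac1{d_k}=0$; (EJ2) $\sum_{k=1}^4\frac{t_k}{d_k}=0$; (BB) $\sum_{k=1}^4\frac{t_k^2}{d_k}+\sum_{j=1}^3\frac{(\lambda_j+1)^2}{\lambda_j}=16$; (CS) $\lambda_1+\lambda_2+\lambda_3=1$. Equalities between rational functions are understood at points where both sides are defined. "Can be derived from (EJ1), (EJ2), (BB), (CS)" means that the relation holds at every point $(t;d;\lambda)\in\mathbb C^{11}$ with all $d_k\neq0$, $\lambda_j\ne0$ that satisfies these four relations and at which both sides are defined. *)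

theory Defs
  imports
    "HOL-Analysis.Analysis"
    "HOL-Library.Poly_Mapping"
    "HOL-Library.Landau_Symbols"
    "HOL-Computational_Algebra.Fraction_Field"
begin

section \<open>Rational functions on complex affine space\<close>

text \<open>
  Polynomials over the complex numbers in variables indexed by a finite type, and their
  field of fractions. The linear order on the index type is only needed for the library's
  proof that the polynomial ring is an integral domain.
\<close>

type_synonym 'n cpoly = "('n \<Rightarrow>\<^sub>0 nat) \<Rightarrow>\<^sub>0 complex"
type_synonym 'n ratfun = "'n cpoly fract"

definition poly_eval :: "'n::finite cpoly \<Rightarrow> complex ^ 'n \<Rightarrow> complex" where
  "poly_eval p a =
     (\<Sum>m\<in>Poly_Mapping.keys p. Poly_Mapping.lookup p m *
        (\<Prod>i\<in>UNIV. (a $ i) ^ Poly_Mapping.lookup m i))"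

text \<open>
  A rational function is defined at \<open>a\<close> if some representation of it as a fraction has a
  denominator that does not vanish at \<open>a\<close>; its value is computed from any such
  representation (lemma \<open>ratfun_value_Fract\<close> below).
\<close>

definition ratfun_defined ::
  "'n::{finite,linorder} ratfun \<Rightarrow> complex ^ 'n::{finite,linorder} \<Rightarrow> bool" where
  "ratfun_defined R a \<longleftrightarrow> (\<exists>p q. R = Fract p q \<and> poly_eval q a \<noteq> 0)"

definition ratfun_value ::
  "'n::{finite,linorder} ratfun \<Rightarrow> complex ^ 'n::{finite,linorder} \<Rightarrow> complex" where
  "ratfun_value R a =
     (THE c. \<exists>p q. R = Fract p q \<and> poly_eval q a \<noteq> 0 \<and> c = poly_eval p a / poly_eval q a)"

definition symmetric_ratfun :: "'n::{finite,linorder} ratfun \<Rightarrow> bool" where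
  "symmetric_ratfun r \<longleftrightarrow>
     (\<forall>\<sigma> a. bij \<sigma> \<longrightarrow> ratfun_defined r a \<longrightarrow> ratfun_defined r (\<chi> i. a $ \<sigma> i) \<longrightarrow>
        ratfun_value r (\<chi> i. a $ \<sigma> i) = ratfun_value r a)"

lemma poly_eval_zero [simp]: "poly_eval 0 a = 0"
  by (simp add: poly_eval_def)

lemma poly_eval_single [simp]:
  "poly_eval (Poly_Mapping.single m c) a = c * (\<Prod>i\<in>UNIV. (a $ i) ^ Poly_Mapping.lookup m i)"
  by (cases "c = 0") (simp_all add: poly_eval_def)

lemma poly_eval_add [simp]: "poly_eval (p + q) a = poly_eval p a + poly_eval q a"
  unfolding poly_eval_def
  by (rule setsum_keys_plus_distrib) (simp_all add: algebra_simps)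

lemma cpoly_induct [case_names zero add]:
  fixes p :: "'n cpoly"
  assumes "P 0" and "\<And>p m c. P p \<Longrightarrow> P (p + Poly_Mapping.single m c)"
  shows "P p"
proof (induction p rule: update_induct)
  case const
  show ?case by (rule assms(1))
next
  case (update f m c)
  have "Poly_Mapping.update m c f = f + Poly_Mapping.single m c"
    using update(1)
    by (intro poly_mapping_eqI)
       (auto simp: lookup_update lookup_add lookup_single when_def in_keys_iff)
  then show ?case using assms(2) update by metis
qed

lemma poly_eval_mult [simp]: "poly_eval (p * q) a = poly_eval p a * poly_eval q a"
proof -
  have s: "poly_eval (p * Poly_Mapping.single m c) a
      = poly_eval p a * poly_eval (Poly_Mapping.single m c) a" for p m c
    by (induction p rule: cpoly_induct)
       (simp_all add: distrib_right mult_single lookup_add power_add prod.distrib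
          del: mult_cancel_right)
  show ?thesis
    by (induction q rule: cpoly_induct) (simp_all only: s distrib_left poly_eval_add
        poly_eval_zero mult_zero_right)
qed

lemma ratfun_value_Fract:
  assumes "poly_eval q a \<noteq> 0"
  shows "ratfun_value (Fract p q) a = poly_eval p a / poly_eval q a"
  unfolding ratfun_value_def
proof (rule the_equality)
  show "\<exists>p' q'. Fract p q = Fract p' q' \<and> poly_eval q' a \<noteq> 0 \<and>
      poly_eval p a / poly_eval q a = poly_eval p' a / poly_eval q' a"
    using assms by blast
next
  fix c
  assume "\<exists>p' q'. Fract p q = Fract p' q' \<and> poly_eval q' a \<noteq> 0 \<and>
      c = poly_eval p' a / poly_eval q' a"
  then obtain p' q' where *: "Fract p q = Fract p' q'" "poly_eval q' a \<noteq> 0"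
      "c = poly_eval p' a / poly_eval q' a" by blast
  have "q \<noteq> 0" "q' \<noteq> 0" using assms * by auto
  with * have "p * q' = p' * q" by (simp add: eq_fract)
  then have "poly_eval p a * poly_eval q' a = poly_eval p' a * poly_eval q a"
    by (metis poly_eval_mult)
  then show "c = poly_eval p a / poly_eval q a"
    using assms *(2,3) by (simp add: frac_eq_eq)
qed


section \<open>Quadratic vector fields\<close>

text \<open>\<open>Quadratic a b c d e f\<close> is the polynomial
  \<open>a + b x + c y + d x\<^sup>2 + e x y + f y\<^sup>2\<close>, and a pair \<open>(P, Q)\<close> of these is the vector field
  with components \<open>P\<close> and \<open>Q\<close>.\<close>

datatype quadratic = Quadratic (c00: complex) (c10: complex) (c01: complex)
                               (c20: complex) (c11: complex) (c02: complex)

definition top_eval :: "quadratic \<Rightarrow> complex ^ 2 \<Rightarrow> complex" where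
  "top_eval f p = c20 f * (p $ 1)\<^sup>2 + c11 f * p $ 1 * p $ 2 + c02 f * (p $ 2)\<^sup>2"

definition quad_eval :: "quadratic \<Rightarrow> complex ^ 2 \<Rightarrow> complex" where
  "quad_eval f p = c00 f + c10 f * p $ 1 + c01 f * p $ 2 + top_eval f p"

type_synonym vfield = "quadratic \<times> quadratic"

definition vf_eval :: "vfield \<Rightarrow> complex ^ 2 \<Rightarrow> complex ^ 2" where
  "vf_eval v p = vector [quad_eval (fst v) p, quad_eval (snd v) p]"

definition singularities :: "vfield \<Rightarrow> (complex ^ 2) set" where
  "singularities v = {p. vf_eval v p = 0}"

definition jacobian_at :: "vfield \<Rightarrow> complex ^ 2 \<Rightarrow> complex ^ 2 ^ 2" where
  "jacobian_at v p = (\<chi> i j. deriv (\<lambda>s. vf_eval v (p + s *s axis j 1) $ i) 0)"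

text \<open>The form \<open>y P\<^sub>2 - x Q\<^sub>2\<close>: the line at infinity is invariant iff it is nonzero, and then
  its zeros in the projective line are the singular points at infinity.\<close>

definition infinity_form :: "vfield \<Rightarrow> complex ^ 2 \<Rightarrow> complex" where
  "infinity_form v p = p $ 2 * top_eval (fst v) p - p $ 1 * top_eval (snd v) p"

text \<open>Points of the projective line are represented as lines through the origin.\<close>

definition singularities_at_infinity :: "vfield \<Rightarrow> (complex ^ 2) set set" where
  "singularities_at_infinity v =
     (\<lambda>p. range (\<lambda>c. c *s p)) ` {p. p \<noteq> 0 \<and> infinity_form v p = 0}"

text \<open>A finite set of singularities consists of isolated ones, so the first condition says that
  there are exactly four singularities in the affine plane and that these are isolated.\<close>

definition nondegenerate :: "vfield \<Rightarrow> bool" where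
  "nondegenerate v \<longleftrightarrow>
     card (singularities v) = 4 \<and>
     (\<exists>p. infinity_form v p \<noteq> 0) \<and>
     card (singularities_at_infinity v) = 3"


section \<open>Extended spectra\<close>

text \<open>
  In the coordinates \<open>z = 1/x\<close>, \<open>w = y/x\<close> one has \<open>z' = - z\<^sup>2 P\<close> and \<open>w' = z (Q - w P)\<close>, with
  \<open>P\<close> and \<open>Q\<close> evaluated at \<open>(x, y) = (1/z, w/z)\<close>; hence the following expression for \<open>dz/dw\<close>.
\<close>

definition slope_at_infinity :: "vfield \<Rightarrow> complex \<Rightarrow> complex \<Rightarrow> complex" where
  "slope_at_infinity v z w =
     (let p = vector [1 / z, w / z]
      in - z * quad_eval (fst v) p / (quad_eval (snd v) p - w * quad_eval (fst v) p))"

text \<open>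
  The case in which no singular point at infinity lies in the direction \<open>x = 0\<close>; the singular
  points are then the points \<open>(z, w) = (0, w\<^sub>j)\<close>, where the \<open>w\<^sub>j\<close> are the zeros of
  \<open>w P\<^sub>2(1, w) - Q\<^sub>2(1, w)\<close>.
\<close>

definition char_numbers_chart :: "vfield \<Rightarrow> complex ^ 3 \<Rightarrow> bool" where
  "char_numbers_chart v l \<longleftrightarrow>
     infinity_form v (vector [0, 1]) \<noteq> 0 \<and>
     (\<exists>w :: complex ^ 3.
        bij_betw (($) w) UNIV {u. infinity_form v (vector [1, u]) = 0} \<and>
        (\<forall>u. u \<notin> range (($) w) \<longrightarrow>
           (\<lambda>z. slope_at_infinity v z u - z * (\<Sum>j\<in>UNIV. l $ j / (u - w $ j)))
             \<in> O[at 0](\<lambda>z. z\<^sup>2)))"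

text \<open>In general, first apply a linear change of coordinates \<open>A\<close>, which turns \<open>v\<close> into
  \<open>v' = A \<circ> v \<circ> A\<^sup>-\<^sup>1\<close>.\<close>

definition char_numbers :: "vfield \<Rightarrow> complex ^ 3 \<Rightarrow> bool" where
  "char_numbers v l \<longleftrightarrow>
     (\<exists>(A :: complex ^ 2 ^ 2) v'. invertible A \<and>
        (\<forall>p. vf_eval v' (A *v p) = A *v vf_eval v p) \<and> char_numbers_chart v' l)"

text \<open>\<open>(t, d, l)\<close> is the extended spectrum of \<open>v\<close> for some enumeration of the finite
  singularities and some enumeration of the singularities at infinity.\<close>

definition extended_spectrum ::
  "vfield \<Rightarrow> complex ^ 4 \<Rightarrow> complex ^ 4 \<Rightarrow> complex ^ 3 \<Rightarrow> bool" where
  "extended_spectrum v t d l \<longleftrightarrow>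
     (\<exists>p :: complex ^ 2 ^ 4. bij_betw (($) p) UNIV (singularities v) \<and>
        (\<forall>k. t $ k = trace (jacobian_at v (p $ k)) \<and> d $ k = det (jacobian_at v (p $ k)))) \<and>
     char_numbers v l"


section \<open>Relations between the extended spectra\<close>

definition EJ1 :: "complex ^ 4 \<Rightarrow> bool" where
  "EJ1 d \<longleftrightarrow> (\<Sum>k\<in>UNIV. 1 / d $ k) = 0"

definition EJ2 :: "complex ^ 4 \<Rightarrow> complex ^ 4 \<Rightarrow> bool" where
  "EJ2 t d \<longleftrightarrow> (\<Sum>k\<in>UNIV. t $ k / d $ k) = 0"

definition BB :: "complex ^ 4 \<Rightarrow> complex ^ 4 \<Rightarrow> complex ^ 3 \<Rightarrow> bool" where
  "BB t d l \<longleftrightarrow>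
     (\<Sum>k\<in>UNIV. (t $ k)\<^sup>2 / d $ k) + (\<Sum>j\<in>UNIV. (l $ j + 1)\<^sup>2 / l $ j) = 16"

definition CS :: "complex ^ 3 \<Rightarrow> bool" where
  "CS l \<longleftrightarrow> (\<Sum>j\<in>UNIV. l $ j) = 1"

definition join :: "complex ^ 4 \<Rightarrow> complex ^ 4 \<Rightarrow> complex ^ 8" where
  "join t d = vector [t $ 1, t $ 2, t $ 3, t $ 4, d $ 1, d $ 2, d $ 3, d $ 4]"

lemma join_nth [simp]:
  "join t d $ 1 = t $ 1" "join t d $ 2 = t $ 2" "join t d $ 3 = t $ 3" "join t d $ 4 = t $ 4"
  "join t d $ 5 = d $ 1" "join t d $ 6 = d $ 2" "join t d $ 7 = d $ 3" "join t d $ 8 = d $ 4"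
  by (simp_all add: join_def vector_def)

text \<open>The relation \<open>R(t; d) = r(\<lambda>)\<close>, understood at points where both sides are defined.\<close>

definition relation_at ::
  "8 ratfun \<Rightarrow> 3 ratfun \<Rightarrow> complex ^ 4 \<Rightarrow> complex ^ 4 \<Rightarrow> complex ^ 3 \<Rightarrow> bool" where
  "relation_at R r t d l \<longleftrightarrow>
     (ratfun_defined R (join t d) \<longrightarrow> ratfun_defined r l \<longrightarrow>
        ratfun_value R (join t d) = ratfun_value r l)"

definition derivable_from_classical :: "8 ratfun \<Rightarrow> 3 ratfun \<Rightarrow> bool" where
  "derivable_from_classical R r \<longleftrightarrow>
     (\<forall>t d l. (\<forall>k. d $ k \<noteq> 0) \<longrightarrow> (\<forall>j. l $ j \<noteq> 0) \<longrightarrow>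
        EJ1 d \<longrightarrow> EJ2 t d \<longrightarrow> BB t d l \<longrightarrow> CS l \<longrightarrow> relation_at R r t d l)"

end

(*
Every generic quadratic vector field is affinely equivalent to M (x^2 - y - k, y^2 - x - m) for a
2x2 matrix M. Transposing M preserves the finite singular points and their traces and determinants
t, d, but changes the characteristic numbers; this is the twin vector field. The numbers
lambda, lambda' of a pair of twins satisfy (CS), have the same sum s of inverses by (BB), and their
products can be prescribed independently of each other. Hence R(t; d) = r(lambda) = r(lambda')
forces r to be a function of s alone on the plane (CS). Since almost all (t; d) satisfying (EJ1) and
(EJ2) come from a vector field, R(t; d) equals that function of s, and s is given by (BB).

Rational functions of lambda are handled by averaging over all enumerations of the lambda_j, which
turns polynomials in lambda into polynomials in the product of the lambda_j, for fixed s. The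
exceptional points are reached as limits of generic ones.
*)

theory Submission
  imports
    Defs
    "HOL-Complex_Analysis.Complex_Singularities"
    "HOL-Computational_Algebra.Fundamental_Theorem_Algebra"
begin

section \<open>Polynomial functions\<close>

text \<open>The map (x^2 - y - k, y^2 - x - m) is a gradient, so its Jacobian S is symmetric and
  tr(M S) = tr(M^T S), det(M S) = det(M^T S): hence twins share t and d. For M with rows (\<alpha>,
  \<beta>), (\<gamma>, \<delta>), X = \<alpha>\<delta> and Y = \<beta>\<gamma>, one has s = (X - 9Y)
  / (X - Y), again invariant under transposition, whereas the product of the characteristic numbers
  involves \<beta>\<alpha>^3 + \<gamma>\<delta>^3, which is not. The obstacle is vanishing
  denominators: the given relation says nothing where they vanish, and twins with prescribed
  products may lie there. The denominator of r is absorbed by an additional factor; that of R is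
  avoided by moving along entire curves of parameters and passing to the limit. Averaging could also
  lose the value of r at a given enumeration; a polynomial vanishing at the other enumerations
  prevents this.\<close>

lemma poly_eval_one [simp]: "poly_eval 1 a = 1"
  unfolding single_one[symmetric] by (simp del: single_one)

lemma poly_eval_coordinate:
  "poly_eval (Poly_Mapping.single (Poly_Mapping.single i 1) 1) a = a $ (i::'n::finite)"
proof -
  have "(\<Prod>j\<in>UNIV. (a $ j) ^ Poly_Mapping.lookup (Poly_Mapping.single i 1) j)
      = (\<Prod>j\<in>UNIV. if j = i then a $ j else 1)"
    by (intro prod.cong) (auto simp: lookup_single when_def)
  then show ?thesis by simp
qed

lemma poly_eval_const: "poly_eval (Poly_Mapping.single 0 c) a = c"
  by simp

text \<open>A product of linear factors, one for each \<open>z\<close>, in a coordinate where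
  \<open>z\<close> differs from \<open>x\<close>. With \<open>Z\<close> containing the other
  enumerations of some \<open>l\<close>, a sum over enumerations retains only the value at
  \<open>l\<close>.\<close>

lemma exists_separating_cpoly:
  fixes x :: "complex ^ 'n::finite"
  assumes "finite Z" "x \<notin> Z"
  shows "\<exists>h. poly_eval h x \<noteq> 0 \<and> (\<forall>z\<in>Z. poly_eval h z = 0)"
  using assms
proof (induction Z rule: finite_induct)
  case empty
  then show ?case by (intro exI[of _ 1]) simp
next
  case (insert z Z)
  then obtain h where h: "poly_eval h x \<noteq> 0" "\<forall>z\<in>Z. poly_eval h z = 0" by auto
  from insert.prems obtain i where i: "x $ i \<noteq> z $ i" by (auto simp: vec_eq_iff)
  define k :: "'n cpoly" where "k = Poly_Mapping.single (Poly_Mapping.single i 1) 1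
      + Poly_Mapping.single 0 (- (z $ i))"
  have k: "poly_eval k y = y $ i - z $ i" for y
    unfolding k_def poly_eval_add poly_eval_coordinate poly_eval_const by simp
  show ?case
    using h i by (intro exI[of _ "h * k"]) (auto simp: k)
qed

lemma holomorphic_on_poly_eval:
  fixes x :: "complex \<Rightarrow> complex ^ 'n::finite"
  assumes "\<And>i. (\<lambda>z. x z $ i) holomorphic_on S"
  shows "(\<lambda>z. poly_eval p (x z)) holomorphic_on S"
  unfolding poly_eval_def by (intro holomorphic_intros assms)

lemma tendsto_poly_eval [tendsto_intros]:
  fixes x :: "'a \<Rightarrow> complex ^ 'n::finite"
  assumes "(x \<longlongrightarrow> a) F"
  shows "((\<lambda>z. poly_eval p (x z)) \<longlongrightarrow> poly_eval p a) F"
  unfolding poly_eval_def by (intro tendsto_intros assms)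

text \<open>Zeros of a nonzero entire function are isolated, so \<open>a\<close> may be far from
  \<open>b\<close>. This carries the nonvanishing of a denominator along a curve of
  parameters.\<close>

lemma entire_eventually_nonzero:
  assumes "f holomorphic_on UNIV" "f a \<noteq> 0"
  shows "\<forall>\<^sub>F z in at b. f z \<noteq> 0"
  using non_zero_neighbour_alt[of f UNIV b a] assms
  by (auto elim: eventually_mono)

lemma exhaust_8:
  fixes x :: 8
  shows "x = 1 \<or> x = 2 \<or> x = 3 \<or> x = 4 \<or> x = 5 \<or> x = 6 \<or> x = 7 \<or> x = 8"
proof (induct x)
  case (of_int z)
  then have "z = 0 \<or> z = 1 \<or> z = 2 \<or> z = 3 \<or> z = 4 \<or> z = 5 \<or> z = 6 \<or> z = 7" by fastforce
  then show ?case by auto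
qed

lemma forall_8:
  "(\<forall>i::8. P i) \<longleftrightarrow> P 1 \<and> P 2 \<and> P 3 \<and> P 4 \<and> P 5 \<and> P 6 \<and> P 7 \<and> P 8"
  by (metis exhaust_8)

lemma holomorphic_on_join:
  assumes "\<And>i. (\<lambda>z. t z $ i) holomorphic_on S" "\<And>i. (\<lambda>z. d z $ i) holomorphic_on S"
  shows "(\<lambda>z. join (t z) (d z) $ i) holomorphic_on S"
proof -
  have "\<forall>i. (\<lambda>z. join (t z) (d z) $ i) holomorphic_on S"
    unfolding forall_8 join_nth using assms by blast
  then show ?thesis by blast
qed

lemma tendsto_join [tendsto_intros]:
  assumes "(t \<longlongrightarrow> t0) F" "(d \<longlongrightarrow> d0) F"
  shows "((\<lambda>z. join (t z) (d z)) \<longlongrightarrow> join t0 d0) F"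
proof (rule vec_tendstoI)
  have "\<forall>i. ((\<lambda>z. join (t z) (d z) $ i) \<longlongrightarrow> join t0 d0 $ i) F"
    unfolding forall_8 join_nth using assms by (intro conjI tendsto_vec_nth)
  then show "((\<lambda>z. join (t z) (d z) $ i) \<longlongrightarrow> join t0 d0 $ i) F" for i by blast
qed

section \<open>Vector fields in normal form\<close>

text \<open>At \<open>x = a\<close> the numerator becomes (a + b)(a + c). The left side is P_2(1, x)
  / (x P_2(1, x) - Q_2(1, x)) for the normal form with directions a, b, c at infinity, so its
  residues are the characteristic numbers.\<close>

lemma partial_fractions_at_infinity:
  fixes a b c x :: complex
  assumes "a \<noteq> b" "a \<noteq> c" "b \<noteq> c" "x \<noteq> a" "x \<noteq> b" "x \<noteq> c"
  shows "(a * b + a * c + b * c + x\<^sup>2) / ((x - a) * (x - b) * (x - c))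
    = (a + b) * (a + c) / ((a - b) * (a - c)) / (x - a)
    + (a + b) * (b + c) / ((b - a) * (b - c)) / (x - b)
    + (a + c) * (b + c) / ((c - a) * (c - b)) / (x - c)"
proof -
  have nz: "a - b \<noteq> 0" "a - c \<noteq> 0" "b - c \<noteq> 0" "x - a \<noteq> 0" "x - b \<noteq> 0" "x - c \<noteq> 0"
    using assms by auto
  have e: "(b - a) * (b - c) = - ((a - b) * (b - c))" "(c - a) * (c - b) = (a - c) * (b - c)"
    by algebra+
  show ?thesis unfolding e using nz
    by (simp add: divide_simps) (simp add: algebra_simps power2_eq_square)
qed

text \<open>In the elementary symmetric functions of a, b, c, (a + b)(a + c)(b + c) = e1 e2 - e3.
  The sum of inverses is therefore (e1 e2 - 9 e3) / (e1 e2 - e3), a function of the ratio of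
  \<alpha>\<delta> to \<beta>\<gamma>, while the product also involves the discriminant.\<close>

lemma sum_char_numbers:
  fixes a b c :: complex
  assumes "a \<noteq> b" "a \<noteq> c" "b \<noteq> c"
  defines "p \<equiv> (a + b) * (a + c) / ((a - b) * (a - c))"
    and "q \<equiv> (a + b) * (b + c) / ((b - a) * (b - c))"
    and "r \<equiv> (a + c) * (b + c) / ((c - a) * (c - b))"
  shows "p + q + r = 1"
    and "p * q * r * ((a - b) * (a - c) * (b - c))\<^sup>2 = - ((a + b) * (a + c) * (b + c))\<^sup>2"
    and "(p * q + p * r + q * r) * ((a + b) * (a + c) * (b + c))
      = p * q * r * ((a + b + c) * (a * b + a * c + b * c) - 9 * (a * b * c))"
proof -
  have nz: "a - b \<noteq> 0" "a - c \<noteq> 0" "b - c \<noteq> 0"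
    using assms by auto
  have e: "(b - a) * (b - c) = - ((a - b) * (b - c))" "(c - a) * (c - b) = (a - c) * (b - c)"
    by algebra+
  show "p + q + r = 1" unfolding p_def q_def r_def e using nz
    by (simp add: divide_simps) (simp add: algebra_simps power2_eq_square)
  show "p * q * r * ((a - b) * (a - c) * (b - c))\<^sup>2 = - ((a + b) * (a + c) * (b + c))\<^sup>2"
    unfolding p_def q_def r_def e using nz
    by (simp add: divide_simps) (simp add: algebra_simps power2_eq_square)
  show "(p * q + p * r + q * r) * ((a + b) * (a + c) * (b + c))
      = p * q * r * ((a + b + c) * (a * b + a * c + b * c) - 9 * (a * b * c))"
    unfolding p_def q_def r_def e using nz
    by (simp add: divide_simps) (simp add: algebra_simps power2_eq_square)
qed

text \<open>The vector field \<open>M \<cdot> (x\<^sup>2 - y - \<kappa>, y\<^sup>2 - x - \<mu>)\<close>, where \<open>M\<close> has rows \<open>(\<alpha>, \<beta>)\<close> and \<open>(\<gamma>, \<delta>)\<close>. Its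
  singular points and its finite spectrum do not change if \<open>M\<close> is transposed, its characteristic
  numbers do.\<close>

definition normal_field :: "complex \<Rightarrow> complex \<Rightarrow> complex \<Rightarrow> complex \<Rightarrow> complex \<Rightarrow> complex \<Rightarrow> vfield" where
  "normal_field \<alpha> \<beta> \<gamma> \<delta> \<kappa> \<mu> =
     (Quadratic (- \<alpha> * \<kappa> - \<beta> * \<mu>) (- \<beta>) (- \<alpha>) \<alpha> 0 \<beta>,
      Quadratic (- \<gamma> * \<kappa> - \<delta> * \<mu>) (- \<delta>) (- \<gamma>) \<gamma> 0 \<delta>)"

lemma vf_eval_normal_field:
  "vf_eval (normal_field \<alpha> \<beta> \<gamma> \<delta> \<kappa> \<mu>) p =
     vector [\<alpha> * ((p $ 1)\<^sup>2 - p $ 2 - \<kappa>) + \<beta> * ((p $ 2)\<^sup>2 - p $ 1 - \<mu>),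
             \<gamma> * ((p $ 1)\<^sup>2 - p $ 2 - \<kappa>) + \<delta> * ((p $ 2)\<^sup>2 - p $ 1 - \<mu>)]"
  by (simp add: vf_eval_def normal_field_def quad_eval_def top_eval_def vec_eq_iff forall_2
      algebra_simps)

lemma infinity_form_normal_field:
  "infinity_form (normal_field \<alpha> \<beta> \<gamma> \<delta> \<kappa> \<mu>) p =
     \<beta> * (p $ 2) ^ 3 - \<delta> * (p $ 2)\<^sup>2 * p $ 1 + \<alpha> * p $ 2 * (p $ 1)\<^sup>2 - \<gamma> * (p $ 1) ^ 3"
  by (simp add: infinity_form_def normal_field_def top_eval_def algebra_simps
      power2_eq_square power3_eq_cube)

lemma jacobian_normal_field:
  fixes \<alpha> \<beta> \<gamma> \<delta> \<kappa> \<mu> :: complex and p :: "complex ^ 2"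
  defines "J \<equiv> jacobian_at (normal_field \<alpha> \<beta> \<gamma> \<delta> \<kappa> \<mu>) p"
  shows "J $ 1 $ 1 = 2 * \<alpha> * p $ 1 - \<beta>" "J $ 1 $ 2 = 2 * \<beta> * p $ 2 - \<alpha>"
    "J $ 2 $ 1 = 2 * \<gamma> * p $ 1 - \<delta>" "J $ 2 $ 2 = 2 * \<delta> * p $ 2 - \<gamma>"
  unfolding J_def jacobian_at_def vf_eval_normal_field vec_lambda_beta vector_2
  by (rule DERIV_imp_deriv; auto intro!: derivative_eq_intros simp: axis_def algebra_simps)+

lemma singularities_normal_field:
  assumes "\<alpha> * \<delta> - \<beta> * \<gamma> \<noteq> 0"
  shows "singularities (normal_field \<alpha> \<beta> \<gamma> \<delta> \<kappa> \<mu>) =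
    (\<lambda>x. vector [x, x\<^sup>2 - \<kappa>]) ` {x. (x\<^sup>2 - \<kappa>)\<^sup>2 - x - \<mu> = 0}"
proof -
  have lin: "\<alpha> * f + \<beta> * g = 0 \<and> \<gamma> * f + \<delta> * g = 0 \<longleftrightarrow> f = 0 \<and> g = 0" for f g
  proof
    assume "\<alpha> * f + \<beta> * g = 0 \<and> \<gamma> * f + \<delta> * g = 0"
    then have "(\<alpha> * \<delta> - \<beta> * \<gamma>) * f = 0" "(\<alpha> * \<delta> - \<beta> * \<gamma>) * g = 0" by algebra+
    then show "f = 0 \<and> g = 0" using assms by simp
  qed auto
  have "p \<in> singularities (normal_field \<alpha> \<beta> \<gamma> \<delta> \<kappa> \<mu>) \<longleftrightarrow>
      p $ 2 = (p $ 1)\<^sup>2 - \<kappa> \<and> (p $ 2)\<^sup>2 - p $ 1 - \<mu> = 0" for p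
    unfolding singularities_def vf_eval_normal_field
    by (simp add: vec_eq_iff forall_2 lin) (auto simp: algebra_simps)
  moreover have "p \<in> (\<lambda>x. vector [x, x\<^sup>2 - \<kappa>]) ` {x. (x\<^sup>2 - \<kappa>)\<^sup>2 - x - \<mu> = 0} \<longleftrightarrow>
      p $ 2 = (p $ 1)\<^sup>2 - \<kappa> \<and> (p $ 2)\<^sup>2 - p $ 1 - \<mu> = 0" for p :: "complex ^ 2"
    by (auto simp: image_iff vec_eq_iff forall_2)
  ultimately show ?thesis by blast
qed

text \<open>The residues in \<open>partial_fractions_at_infinity\<close>. Permuting the arguments
  permutes the entries and keeps the field, which yields all enumerations for one field.\<close>

definition infinity_spectrum :: "complex \<Rightarrow> complex \<Rightarrow> complex \<Rightarrow> complex ^ 3" where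
  "infinity_spectrum a b c = vector
     [(a + b) * (a + c) / ((a - b) * (a - c)),
      (a + b) * (b + c) / ((b - a) * (b - c)),
      (a + c) * (b + c) / ((c - a) * (c - b))]"

lemma infinity_form_normal_field_roots:
  fixes a b c \<beta> \<kappa> \<mu> :: complex
  defines "v \<equiv> normal_field (\<beta> * (a * b + a * c + b * c)) \<beta> (\<beta> * (a * b * c)) (\<beta> * (a + b + c)) \<kappa> \<mu>"
  shows "infinity_form v (vector [x, y]) = \<beta> * ((y - a * x) * (y - b * x) * (y - c * x))"
  by (simp add: v_def infinity_form_normal_field algebra_simps power2_eq_square power3_eq_cube)

lemma char_numbers_normal_field:
  fixes a b c \<beta> \<kappa> \<mu> :: complex
  defines "v \<equiv> normal_field (\<beta> * (a * b + a * c + b * c)) \<beta> (\<beta> * (a * b * c)) (\<beta> * (a + b + c)) \<kappa> \<mu>"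
  assumes "\<beta> \<noteq> 0" and abc: "a \<noteq> b" "a \<noteq> c" "b \<noteq> c"
  shows "char_numbers v (infinity_spectrum a b c)"
proof -
  have "char_numbers_chart v (infinity_spectrum a b c)"
    unfolding char_numbers_chart_def
  proof (intro conjI exI[of _ "vector [a, b, c]"] allI impI)
    show "infinity_form v (vector [0, 1]) \<noteq> 0"
      using \<open>\<beta> \<noteq> 0\<close> by (simp add: v_def infinity_form_normal_field_roots)
    have r: "range (($) (vector [a, b, c] :: complex ^ 3)) = {a, b, c}"
      by (simp add: UNIV_3 insert_commute)
    have "inj (($) (vector [a, b, c] :: complex ^ 3))"
      using abc by (auto simp: inj_def forall_3)
    moreover have "{u. infinity_form v (vector [1, u]) = 0} = {a, b, c}"
      using \<open>\<beta> \<noteq> 0\<close> by (auto simp: v_def infinity_form_normal_field_roots)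
    ultimately show "bij_betw (($) (vector [a, b, c] :: complex ^ 3)) UNIV
        {u. infinity_form v (vector [1, u]) = 0}"
      by (simp add: bij_betw_def r)
    fix u assume "u \<notin> range (($) (vector [a, b, c] :: complex ^ 3))"
    then have u: "u \<noteq> a" "u \<noteq> b" "u \<noteq> c" unfolding r by auto
    define C where "C = \<beta> * ((u - a) * (u - b) * (u - c))"
    have C: "C \<noteq> 0" using u \<open>\<beta> \<noteq> 0\<close> by (simp add: C_def)
    define P where "P = top_eval (fst v) (vector [1, u])"
    define P1 where "P1 = c10 (fst v) + c01 (fst v) * u"
    define Q1 where "Q1 = c10 (snd v) + c01 (snd v) * u"
    define N where "N = (\<lambda>z. c00 (fst v) * z + P1)"
    define E where "E = (\<lambda>z. (c00 (snd v) - u * c00 (fst v)) * z + (Q1 - u * P1))"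
    have Q: "top_eval (snd v) (vector [1, u]) - u * P = - C"
      using infinity_form_normal_field_roots[of \<beta> a b c \<kappa> \<mu> 1 u]
      by (simp add: infinity_form_def P_def C_def v_def algebra_simps)
    have P: "P = \<beta> * (a * b + a * c + b * c + u\<^sup>2)"
      by (simp add: P_def v_def normal_field_def top_eval_def algebra_simps)
    have sum: "(\<Sum>j\<in>UNIV. infinity_spectrum a b c $ j / (u - vector [a, b, c] $ j)) = P / C"
      unfolding P C_def sum_3 infinity_spectrum_def vector_3
      using partial_fractions_at_infinity[OF abc u] \<open>\<beta> \<noteq> 0\<close> by simp
    have slope: "slope_at_infinity v z u = - z * (P + z * N z) / (- C + z * E z)" if "z \<noteq> 0" for z
    proof -
      have p: "quad_eval f (vector [1 / z, u / z]) =
          (top_eval f (vector [1, u]) + (c10 f + c01 f * u) * z + c00 f * z\<^sup>2) / z\<^sup>2" for f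
        using that by (simp add: quad_eval_def top_eval_def field_simps power2_eq_square)
      have d: "quad_eval (snd v) (vector [1 / z, u / z]) - u * quad_eval (fst v) (vector [1 / z, u / z])
          = (- C + z * E z) / z\<^sup>2"
        unfolding p diff_divide_distrib[symmetric] times_divide_eq_right Q[symmetric] E_def P1_def Q1_def P_def
        by (rule arg_cong2[of _ _ _ _ "(/)"]) (simp_all add: algebra_simps power2_eq_square)
      have n: "quad_eval (fst v) (vector [1 / z, u / z]) = (P + z * N z) / z\<^sup>2"
        unfolding p P_def N_def P1_def
        by (rule arg_cong2[of _ _ _ _ "(/)"]) (simp_all add: algebra_simps power2_eq_square)
      show ?thesis
        unfolding slope_at_infinity_def Let_def d unfolding n using that by simp
    qed
    \<comment> \<open>The error divided by z^2. Its denominator tends to -C^2, which is nonzero, so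
      the quotient has a finite limit.\<close>
    define h where "h = (\<lambda>z. - (N z * C + P * E z) / ((- C + z * E z) * C))"
    have den: "((\<lambda>z. - C + z * E z) \<longlongrightarrow> - C + 0 * E 0) (at 0)"
      unfolding E_def by (intro tendsto_intros)
    then have "\<forall>\<^sub>F z in at 0. - C + z * E z \<noteq> 0"
      using C by (intro tendsto_imp_eventually_ne[OF den]) auto
    moreover have "\<forall>\<^sub>F z in at 0. z \<noteq> (0::complex)"
      by (simp add: eventually_at_filter)
    ultimately have ev: "\<forall>\<^sub>F z in at 0. (slope_at_infinity v z u -
        z * (\<Sum>j\<in>UNIV. infinity_spectrum a b c $ j / (u - vector [a, b, c] $ j))) / z\<^sup>2 = h z"
    proof eventually_elim
      case (elim z)
      have "slope_at_infinity v z u - z * (P / C)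
          = - z * ((P + z * N z) * C + P * (- C + z * E z)) / ((- C + z * E z) * C)"
        unfolding slope[OF elim(2)] using elim(1) C by (simp add: divide_simps) (simp add: algebra_simps)
      also have "\<dots> = h z * z\<^sup>2"
        unfolding h_def times_divide_eq_left
        by (rule arg_cong2[of _ _ _ _ "(/)"]) (simp_all add: algebra_simps power2_eq_square)
      finally show ?case unfolding sum using elim(2) by simp
    qed
    have "(h \<longlongrightarrow> - (N 0 * C + P * E 0) / ((- C + 0 * E 0) * C)) (at 0)"
      unfolding h_def N_def E_def using C by (intro tendsto_intros) auto
    then have "((\<lambda>z. (slope_at_infinity v z u -
        z * (\<Sum>j\<in>UNIV. infinity_spectrum a b c $ j / (u - vector [a, b, c] $ j))) / z\<^sup>2)
        \<longlongrightarrow> - (N 0 * C + P * E 0) / ((- C + 0 * E 0) * C)) (at 0)"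
      by (rule Lim_transform_eventually) (use ev in \<open>simp add: eq_commute\<close>)
    then show "(\<lambda>z. slope_at_infinity v z u -
        z * (\<Sum>j\<in>UNIV. infinity_spectrum a b c $ j / (u - vector [a, b, c] $ j)))
        \<in> O[at 0](\<lambda>z. z\<^sup>2)"
      by (rule bigoI_tendsto) (simp add: eventually_at_filter)
  qed
  then show ?thesis
    unfolding char_numbers_def
    by (intro exI[of _ "mat 1"] exI[of _ v]) (simp add: invertible_def exI[of _ "mat 1"])
qed

lemma singularities_at_infinity_normal_field:
  fixes a b c \<beta> \<kappa> \<mu> :: complex
  defines "v \<equiv> normal_field (\<beta> * (a * b + a * c + b * c)) \<beta> (\<beta> * (a * b * c)) (\<beta> * (a + b + c)) \<kappa> \<mu>"
  assumes "\<beta> \<noteq> 0"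
  shows "singularities_at_infinity v = (\<lambda>x. range (\<lambda>s. s *s vector [1, x])) ` {a, b, c}"
proof
  show "(\<lambda>x. range (\<lambda>s. s *s vector [1, x])) ` {a, b, c} \<subseteq> singularities_at_infinity v"
  proof
    fix L assume "L \<in> (\<lambda>x. range (\<lambda>s. s *s vector [1, x] :: complex ^ 2)) ` {a, b, c}"
    then obtain x where x: "x \<in> {a, b, c}" "L = range (\<lambda>s. s *s vector [1, x])" by blast
    have "infinity_form v (vector [1, x]) = 0"
      using x(1) by (auto simp: v_def infinity_form_normal_field_roots)
    moreover have "vector [1, x] \<noteq> (0 :: complex ^ 2)" by (simp add: vec_eq_iff forall_2)
    ultimately show "L \<in> singularities_at_infinity v"
      unfolding singularities_at_infinity_def x(2) by blast
  qed
  show "singularities_at_infinity v \<subseteq> (\<lambda>x. range (\<lambda>s. s *s vector [1, x])) ` {a, b, c}"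
  proof
    fix L assume "L \<in> singularities_at_infinity v"
    then obtain p where p: "p \<noteq> 0" "infinity_form v p = 0" "L = range (\<lambda>s. s *s p)"
      unfolding singularities_at_infinity_def by blast
    have "p = vector [p $ 1, p $ 2]" by (simp add: vec_eq_iff forall_2)
    with p(2) have f: "(p $ 2 - a * p $ 1) * (p $ 2 - b * p $ 1) * (p $ 2 - c * p $ 1) = 0"
      using \<open>\<beta> \<noteq> 0\<close> infinity_form_normal_field_roots[of \<beta> a b c \<kappa> \<mu> "p $ 1" "p $ 2"]
      by (simp add: v_def)
    then obtain x where x: "x \<in> {a, b, c}" "p $ 2 = x * p $ 1" by auto
    have p1: "p $ 1 \<noteq> 0" using x(2) p(1) by (auto simp: vec_eq_iff forall_2)
    have e: "p = (p $ 1) *s vector [1, x]" using x(2) by (simp add: vec_eq_iff forall_2)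
    have "range (\<lambda>s. s *s p) = (\<lambda>t. t *s vector [1, x]) ` range (\<lambda>s. s * p $ 1)"
      unfolding image_image by (subst e) simp
    also have "range (\<lambda>s. s * p $ 1) = UNIV"
      using p1 by (intro surjI[of _ "\<lambda>s. s / p $ 1"]) simp
    finally show "L \<in> (\<lambda>x. range (\<lambda>s. s *s vector [1, x])) ` {a, b, c}"
      using x(1) p(3) by blast
  qed
qed

text \<open>The Jacobian is M times the matrix with rows (2x, -1), (-1, 2y), where y = x^2 -
  \<kappa>. Its second factor has determinant 4xy - 1, which is also the derivative at x of the
  quartic whose roots are the u_k.\<close>

proposition normal_field_spectrum:
  fixes a b c \<beta> \<kappa> \<mu> :: complex and u :: "complex ^ 4"
  defines "\<alpha> \<equiv> \<beta> * (a * b + a * c + b * c)" and "\<gamma> \<equiv> \<beta> * (a * b * c)" and "\<delta> \<equiv> \<beta> * (a + b + c)"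
  defines "v \<equiv> normal_field \<alpha> \<beta> \<gamma> \<delta> \<kappa> \<mu>"
  assumes "\<beta> \<noteq> 0" and abc: "a \<noteq> b" "a \<noteq> c" "b \<noteq> c" and "\<alpha> * \<delta> - \<beta> * \<gamma> \<noteq> 0"
    and "inj (($) u)" and roots: "\<And>x. (x\<^sup>2 - \<kappa>)\<^sup>2 - x - \<mu> = 0 \<longleftrightarrow> x \<in> range (($) u)"
  shows "nondegenerate v"
    and "extended_spectrum v (\<chi> k. 2 * \<alpha> * u $ k + 2 * \<delta> * ((u $ k)\<^sup>2 - \<kappa>) - (\<beta> + \<gamma>))
      (\<chi> k. (\<alpha> * \<delta> - \<beta> * \<gamma>) * (4 * u $ k * ((u $ k)\<^sup>2 - \<kappa>) - 1)) (infinity_spectrum a b c)"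
proof -
  define pt :: "complex \<Rightarrow> complex ^ 2" where "pt x = vector [x, x\<^sup>2 - \<kappa>]" for x
  have inj: "inj pt" by (auto simp: pt_def inj_def vec_eq_iff forall_2)
  have s: "singularities v = pt ` range (($) u)"
    using singularities_normal_field[of \<alpha> \<delta> \<beta> \<gamma> \<kappa> \<mu>] assms(9) roots
    by (simp add: v_def pt_def[abs_def])
  have bij: "bij_betw (\<lambda>k. pt (u $ k)) UNIV (singularities v)"
    unfolding s bij_betw_def using inj_compose[OF inj \<open>inj (($) u)\<close>]
    by (simp add: o_def image_image)
  have "infinity_form v (vector [0, 1]) \<noteq> 0"
    using \<open>\<beta> \<noteq> 0\<close> by (simp add: v_def infinity_form_normal_field)
  moreover have "card (singularities v) = 4"
    using bij_betw_same_card[OF bij] by simp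
  moreover have "card (singularities_at_infinity v) = 3"
  proof -
    have "inj (\<lambda>x. range (\<lambda>s. s *s vector [1, x] :: complex ^ 2))"
    proof (rule injI)
      fix x y :: complex
      assume "range (\<lambda>s. s *s vector [1, x] :: complex ^ 2) = range (\<lambda>s. s *s vector [1, y])"
      then have "1 *s vector [1, x] \<in> range (\<lambda>s. s *s vector [1, y] :: complex ^ 2)" by blast
      then obtain s where "1 *s vector [1, x] = (s *s vector [1, y] :: complex ^ 2)" by blast
      then show "x = y" by (simp add: vec_eq_iff forall_2)
    qed
    then have "card (singularities_at_infinity v) = card {a, b, c}"
      unfolding v_def \<alpha>_def \<gamma>_def \<delta>_def singularities_at_infinity_normal_field[OF \<open>\<beta> \<noteq> 0\<close>]
      by (rule card_image[OF inj_on_subset[OF _ subset_UNIV]])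
    then show ?thesis using abc by simp
  qed
  ultimately show "nondegenerate v" unfolding nondegenerate_def by blast
  have "char_numbers v (infinity_spectrum a b c)"
    unfolding v_def \<alpha>_def \<gamma>_def \<delta>_def using \<open>\<beta> \<noteq> 0\<close> abc by (rule char_numbers_normal_field)
  moreover have "trace (jacobian_at v (pt x)) = 2 * \<alpha> * x + 2 * \<delta> * (x\<^sup>2 - \<kappa>) - (\<beta> + \<gamma>)"
    and "det (jacobian_at v (pt x)) = (\<alpha> * \<delta> - \<beta> * \<gamma>) * (4 * x * (x\<^sup>2 - \<kappa>) - 1)" for x
    by (simp_all add: trace_def sum_2 det_2 v_def jacobian_normal_field pt_def algebra_simps)
  ultimately show "extended_spectrum v
      (\<chi> k. 2 * \<alpha> * u $ k + 2 * \<delta> * ((u $ k)\<^sup>2 - \<kappa>) - (\<beta> + \<gamma>))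
      (\<chi> k. (\<alpha> * \<delta> - \<beta> * \<gamma>) * (4 * u $ k * ((u $ k)\<^sup>2 - \<kappa>) - 1)) (infinity_spectrum a b c)"
    unfolding extended_spectrum_def using bij
    by (intro conjI exI[of _ "\<chi> k. pt (u $ k)"]) (simp_all add: vec_lambda_inverse)
qed

section \<open>Symmetric functions of the characteristic numbers\<close>

definition symmetrized :: "3 cpoly \<Rightarrow> complex ^ 3 \<Rightarrow> complex" where
  "symmetrized f l =
     poly_eval f (vector [l $ 1, l $ 2, l $ 3]) + poly_eval f (vector [l $ 1, l $ 3, l $ 2]) +
     poly_eval f (vector [l $ 2, l $ 1, l $ 3]) + poly_eval f (vector [l $ 2, l $ 3, l $ 1]) +
     poly_eval f (vector [l $ 3, l $ 1, l $ 2]) + poly_eval f (vector [l $ 3, l $ 2, l $ 1])"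

text \<open>Given (CS), the relation (BB) fixes \<open>s = \<Sum> 1 / \<lambda>\<^sub>j\<close> in terms of the finite spectrum; \<open>m\<close> is the
  product of the \<open>\<lambda>\<^sub>j\<close>.\<close>

definition char_curve :: "complex \<Rightarrow> complex \<Rightarrow> (complex ^ 3) set" where
  "char_curve s m = {l. l $ 1 + l $ 2 + l $ 3 = 1 \<and>
     l $ 1 * l $ 2 + l $ 1 * l $ 3 + l $ 2 * l $ 3 = s * m \<and> l $ 1 * l $ 2 * l $ 3 = m}"

text \<open>Newton's recurrence, with elementary symmetric functions 1, s m, m on the curve. One
  \<open>P\<close> serves all \<open>m\<close>, so that limits and root counts in \<open>m\<close>
  make sense later.\<close>

lemma power_sums_poly:
  "\<exists>P. \<forall>m. \<forall>l\<in>char_curve s m. (l $ 1) ^ n + (l $ 2) ^ n + (l $ 3) ^ n = poly P m"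
proof (induction n rule: less_induct)
  case (less n)
  consider "n = 0" | "n = 1" | "n = 2" | k where "n = k + 3"
  proof -
    have "n = 0 \<or> n = 1 \<or> n = 2 \<or> n = (n - 3) + 3" by arith
    then show ?thesis using that by blast
  qed
  then show ?case
  proof cases
    case 1
    then show ?thesis by (intro exI[of _ "[:3:]"]) simp
  next
    case 2
    then show ?thesis by (intro exI[of _ "[:1:]"]) (simp add: char_curve_def)
  next
    case 3
    have "(x::complex)\<^sup>2 + y\<^sup>2 + z\<^sup>2 = (x + y + z)\<^sup>2 - 2 * (x * y + x * z + y * z)" for x y z
      by algebra
    then show ?thesis
      using 3 by (intro exI[of _ "[:1, - 2 * s:]"]) (simp add: char_curve_def del: distrib_left_numeral)
  next
    case 4
    obtain P where P: "\<And>i m l. i < 3 \<Longrightarrow> l \<in> char_curve s m \<Longrightarrow>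
        (l $ 1) ^ (k + i) + (l $ 2) ^ (k + i) + (l $ 3) ^ (k + i) = poly (P i) m"
    proof -
      have "\<forall>i. \<exists>P. i < 3 \<longrightarrow> (\<forall>m. \<forall>l\<in>char_curve s m.
          (l $ 1) ^ (k + i) + (l $ 2) ^ (k + i) + (l $ 3) ^ (k + i) = poly P m)"
        using less.IH 4 by auto
      then show ?thesis using that by metis
    qed
    have newton: "x ^ (k + 3) + y ^ (k + 3) + z ^ (k + 3) =
      (x + y + z) * (x ^ (k + 2) + y ^ (k + 2) + z ^ (k + 2))
      - (x * y + x * z + y * z) * (x ^ (k + 1) + y ^ (k + 1) + z ^ (k + 1))
      + x * y * z * (x ^ (k + 0) + y ^ (k + 0) + z ^ (k + 0))" for x y z :: complex
    proof -
      \<comment> \<open>Free a, b, c replace x^k, y^k, z^k, which leaves an identity of fixed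
        degree.\<close>
      have "a * x ^ 3 + b * y ^ 3 + c * z ^ 3 = (x + y + z) * (a * x\<^sup>2 + b * y\<^sup>2 + c * z\<^sup>2)
        - (x * y + x * z + y * z) * (a * x ^ 1 + b * y ^ 1 + c * z ^ 1)
        + x * y * z * (a * x ^ 0 + b * y ^ 0 + c * z ^ 0)" for a b c
        by algebra
      then show ?thesis unfolding power_add .
    qed
    have "(l $ 1) ^ n + (l $ 2) ^ n + (l $ 3) ^ n = poly (P 2 - [:0, s:] * P 1 + [:0, 1:] * P 0) m"
      if l: "l \<in> char_curve s m" for l m
    proof -
      have e: "l $ 1 + l $ 2 + l $ 3 = 1" "l $ 1 * l $ 2 * l $ 3 = m"
          "l $ 1 * l $ 2 + l $ 1 * l $ 3 + l $ 2 * l $ 3 = s * m"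
        using l by (simp_all add: char_curve_def)
      show ?thesis
        unfolding 4 newton e using P[OF _ l, of 0] P[OF _ l, of 1] P[OF _ l, of 2] by simp
    qed
    then show ?thesis by blast
  qed
qed

text \<open>A symmetrized monomial is a sum over triples of distinct indices; inclusion-exclusion
  over coinciding indices, with coefficients 1, -1, 2, expresses it by power sums.\<close>

lemma symmetrized_poly:
  "\<exists>P. \<forall>m. \<forall>l\<in>char_curve s m. symmetrized f l = poly P m"
proof (induction f rule: cpoly_induct)
  case zero
  show ?case by (intro exI[of _ 0]) (simp add: symmetrized_def)
next
  case (add f e c)
  then obtain P where P: "\<forall>m. \<forall>l\<in>char_curve s m. symmetrized f l = poly P m" by blast
  obtain S where S: "\<And>n m l. l \<in> char_curve s m \<Longrightarrow>
      (l $ 1) ^ n + (l $ 2) ^ n + (l $ 3) ^ n = poly (S n) m"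
    using power_sums_poly[of s] by metis
  define i j k where "i = Poly_Mapping.lookup e (1::3)" and "j = Poly_Mapping.lookup e (2::3)"
    and "k = Poly_Mapping.lookup e (3::3)"
  have id: "x^i * y^j * z^k + x^i * z^j * y^k + y^i * x^j * z^k + y^i * z^j * x^k + z^i * x^j * y^k
      + z^i * y^j * x^k
    = (x^i + y^i + z^i) * (x^j + y^j + z^j) * (x^k + y^k + z^k)
      - (x^(i+j) + y^(i+j) + z^(i+j)) * (x^k + y^k + z^k)
      - (x^(i+k) + y^(i+k) + z^(i+k)) * (x^j + y^j + z^j)
      - (x^(j+k) + y^(j+k) + z^(j+k)) * (x^i + y^i + z^i)
      + 2 * (x^(i+j+k) + y^(i+j+k) + z^(i+j+k))" for x y z :: complex
  proof -
    have "a * b' * c'' + a * c' * b'' + b * a' * c'' + b * c' * a'' + c * a' * b'' + c * b' * a''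
      = (a + b + c) * (a' + b' + c') * (a'' + b'' + c'')
        - (a * a' + b * b' + c * c') * (a'' + b'' + c'')
        - (a * a'' + b * b'' + c * c'') * (a' + b' + c')
        - (a' * a'' + b' * b'' + c' * c'') * (a + b + c)
        + 2 * (a * a' * a'' + b * b' * b'' + c * c' * c'')" for a b c a' b' c' a'' b'' c'' :: complex
      by algebra
    then show ?thesis unfolding power_add .
  qed
  have prod3: "(\<Prod>n\<in>UNIV. g n) = g 1 * g 2 * g 3" for g :: "3 \<Rightarrow> complex"
    unfolding UNIV_3 by (simp add: ac_simps)
  have single_term: "poly_eval (Poly_Mapping.single e c) (vector [x, y, z]) = c * (x^i * y^j * z^k)"
    for x y z
    unfolding poly_eval_single prod3 vector_3 i_def j_def k_def ..
  have "symmetrized (f + Poly_Mapping.single e c) l = poly (P + smult c (S i * S j * S k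
      - S (i+j) * S k - S (i+k) * S j - S (j+k) * S i + smult 2 (S (i+j+k)))) m"
    if l: "l \<in> char_curve s m" for m l
  proof -
    have "symmetrized (f + Poly_Mapping.single e c) l = symmetrized f l + c *
      ((l$1)^i * (l$2)^j * (l$3)^k + (l$1)^i * (l$3)^j * (l$2)^k + (l$2)^i * (l$1)^j * (l$3)^k
       + (l$2)^i * (l$3)^j * (l$1)^k + (l$3)^i * (l$1)^j * (l$2)^k + (l$3)^i * (l$2)^j * (l$1)^k)"
      unfolding symmetrized_def poly_eval_add single_term by (simp only: algebra_simps)
    then show ?thesis
      unfolding id using P l by (simp add: S[OF l])
  qed
  then show ?case by blast
qed

text \<open>For \<open>\<alpha> \<delta> = X\<close> and \<open>\<beta> \<gamma> = Y\<close> the products of the characteristic numbers of the two twins are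
  determined by \<open>\<beta> \<alpha>\<^sup>3 + \<gamma> \<delta>\<^sup>3\<close> and \<open>\<gamma> \<alpha>\<^sup>3 + \<beta> \<delta>\<^sup>3\<close>, which can therefore be prescribed. The sum and the
  difference of the two factor, which leads to a quadratic equation for \<open>(\<beta> + \<gamma>)\<^sup>2\<close>.\<close>

lemma twin_parameters:
  fixes X Y G G' :: complex
  assumes "X \<noteq> 0" "Y \<noteq> 0"
  shows "\<exists>\<alpha> \<beta>. \<alpha> \<noteq> 0 \<and> \<beta> \<noteq> 0 \<and> \<beta> * \<alpha> ^ 3 + Y / \<beta> * (X / \<alpha>) ^ 3 = G \<and>
    Y / \<beta> * \<alpha> ^ 3 + \<beta> * (X / \<alpha>) ^ 3 = G'"
proof -
  have quadratic: "\<exists>x y. x + y = p \<and> x * y = q" for p q :: complex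
  proof -
    define r where "r = csqrt (p\<^sup>2 - 4 * q)"
    have "r\<^sup>2 = p\<^sup>2 - 4 * q" by (simp add: r_def)
    then have "(p + r) / 2 + (p - r) / 2 = p" "(p + r) / 2 * ((p - r) / 2) = q"
      by (simp_all add: field_simps power2_eq_square)
    then show ?thesis by blast
  qed
  \<comment> \<open>With A = \<alpha>^3, D = \<delta>^3, p = (\<beta> + \<gamma>)^2 and q = (A +
    D)^2, the sum and the difference of the two equations require p q = (G + G')^2 and (p - 4Y)(q -
    4X^3) = (G - G')^2. Given the former, the latter says X^3 p + Y q = K.\<close>
  define K where "K = ((G + G')\<^sup>2 - (G - G')\<^sup>2 + 16 * X ^ 3 * Y) / 4"
  obtain p q where pq: "p * q = (G + G')\<^sup>2" "X ^ 3 * p + Y * q = K"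
  proof -
    obtain x y where "x + y = K" "x * y = X ^ 3 * Y * (G + G')\<^sup>2"
      using quadratic by blast
    then have "x / X ^ 3 * (y / Y) = (G + G')\<^sup>2" "X ^ 3 * (x / X ^ 3) + Y * (y / Y) = K"
      using assms by (simp_all add: field_simps)
    then show ?thesis by (rule that)
  qed
  \<comment> \<open>The signs of the roots are matched so that e f is G + G' itself and not only up
    to sign.\<close>
  obtain e f where ef: "e\<^sup>2 = p" "f\<^sup>2 = q" "e * f = G + G'"
  proof -
    have "(csqrt p * csqrt q)\<^sup>2 = (G + G')\<^sup>2" using pq(1) by (simp add: power_mult_distrib)
    then have "csqrt p * csqrt q = G + G' \<or> csqrt p * csqrt q = - (G + G')"
      by (simp add: power2_eq_iff)
    then show ?thesis
    proof
      assume "csqrt p * csqrt q = G + G'"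
      then show ?thesis by (intro that[of "csqrt p" "csqrt q"]) simp_all
    next
      assume "csqrt p * csqrt q = - (G + G')"
      then show ?thesis by (intro that[of "csqrt p" "- csqrt q"]) simp_all
    qed
  qed
  obtain b c where bc: "b + c = e" "b * c = Y" using quadratic by blast
  obtain A D where AD: "A + D = f" "A * D = X ^ 3" using quadratic by blast
  have sum: "b * A + c * D + (c * A + b * D) = G + G'"
    unfolding ef(3)[symmetric] bc(1)[symmetric] AD(1)[symmetric] by algebra
  have "(b * A + c * D - (c * A + b * D))\<^sup>2 = (G - G')\<^sup>2"
  proof -
    have "(b * A + c * D - (c * A + b * D))\<^sup>2 = ((b + c)\<^sup>2 - 4 * (b * c)) * ((A + D)\<^sup>2 - 4 * (A * D))"
      by algebra
    also have "\<dots> = (p - 4 * Y) * (q - 4 * X ^ 3)" by (simp add: bc AD ef)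
    also have "\<dots> = p * q - 4 * (X ^ 3 * p + Y * q) + 16 * X ^ 3 * Y" by algebra
    also have "\<dots> = (G - G')\<^sup>2" unfolding pq K_def by (simp add: field_simps)
    finally show ?thesis .
  qed
  \<comment> \<open>If the sign is the wrong one, exchanging \<open>b\<close> and \<open>c\<close>
    exchanges the two expressions.\<close>
  then have "b * A + c * D - (c * A + b * D) = G - G' \<or> b * A + c * D - (c * A + b * D) = G' - G"
    unfolding power2_eq_iff by simp
  moreover have half: "x = g \<and> y = h" if "x + y = g + h" "x - y = g - h" for x y g h :: complex
  proof -
    have "2 * x = (x + y) + (x - y)" by simp
    also have "\<dots> = 2 * g" unfolding that by simp
    finally show ?thesis using that by simp
  qed
  ultimately have "\<exists>b c. b * c = Y \<and> b * A + c * D = G \<and> c * A + b * D = G'"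
    using half[OF sum] half[of "b * A + c * D" "c * A + b * D" G' G] sum bc(2)
    by (metis add.commute mult.commute)
  then obtain b c where bc: "b * c = Y" "b * A + c * D = G" "c * A + b * D = G'" by blast
  obtain \<alpha> where \<alpha>: "\<alpha> ^ 3 = A"
    using exists_complex_root[of 3 A] by auto
  have "A \<noteq> 0" "b \<noteq> 0" using AD(2) bc(1) assms by auto
  moreover have "(X / \<alpha>) ^ 3 = D" "Y / b = c"
    using AD(2) bc(1) \<open>A \<noteq> 0\<close> \<open>b \<noteq> 0\<close> by (auto simp: power_divide \<alpha> field_simps)
  ultimately show ?thesis using bc \<alpha> by (intro exI[of _ \<alpha>] exI[of _ b]) auto
qed

text \<open>The second hypothesis is about the discriminant of \<beta> w^3 - \<delta> w^2 + \<alpha>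
  w - \<gamma>. One root \<open>a\<close> exists by the fundamental theorem of algebra;
  \<open>b\<close> and \<open>c\<close> are the roots of the quotient w^2 - g w + h.\<close>

lemma cubic_with_distinct_roots:
  fixes \<alpha> \<beta> \<gamma> \<delta> :: complex
  assumes "\<beta> \<noteq> 0"
    and "(\<alpha> * \<delta>)\<^sup>2 + 18 * (\<alpha> * \<delta>) * (\<beta> * \<gamma>) - 27 * (\<beta> * \<gamma>)\<^sup>2 - 4 * (\<beta> * \<alpha> ^ 3 + \<gamma> * \<delta> ^ 3) \<noteq> 0"
  obtains a b c where "a \<noteq> b" "a \<noteq> c" "b \<noteq> c"
    "\<alpha> = \<beta> * (a * b + a * c + b * c)" "\<gamma> = \<beta> * (a * b * c)" "\<delta> = \<beta> * (a + b + c)"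
proof -
  obtain a where a: "\<beta> * a ^ 3 - \<delta> * a\<^sup>2 + \<alpha> * a - \<gamma> = 0"
  proof -
    have "\<not> constant (poly [:- \<gamma>, \<alpha>, - \<delta>, \<beta>:])"
      using \<open>\<beta> \<noteq> 0\<close> by (simp add: constant_degree)
    then obtain a where "poly [:- \<gamma>, \<alpha>, - \<delta>, \<beta>:] a = 0"
      using fundamental_theorem_of_algebra by blast
    then show ?thesis
      by (intro that[of a]) (simp add: algebra_simps power2_eq_square power3_eq_cube)
  qed
  define g where "g = \<delta> / \<beta> - a"
  define h where "h = \<alpha> / \<beta> - a * g"
  define r where "r = csqrt (g\<^sup>2 - 4 * h)"
  define b c where "b = (g + r) / 2" and "c = (g - r) / 2"
  have "r\<^sup>2 = g\<^sup>2 - 4 * h" by (simp add: r_def)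
  then have bc: "b + c = g" "b * c = h"
    by (simp_all add: b_def c_def field_simps power2_eq_square)
  have "\<beta> * g = \<delta> - \<beta> * a" "\<beta> * h = \<alpha> - \<beta> * (a * g)"
    using \<open>\<beta> \<noteq> 0\<close> by (simp_all add: g_def h_def right_diff_distrib)
  then have d: "\<delta> = \<beta> * (a + b + c)" and e: "\<alpha> = \<beta> * (a * b + a * c + b * c)"
    unfolding bc[symmetric] by algebra+
  from a have f: "\<gamma> = \<beta> * (a * b * c)" unfolding d e by algebra
  have "(\<alpha> * \<delta>)\<^sup>2 + 18 * (\<alpha> * \<delta>) * (\<beta> * \<gamma>) - 27 * (\<beta> * \<gamma>)\<^sup>2 - 4 * (\<beta> * \<alpha> ^ 3 + \<gamma> * \<delta> ^ 3)
      = \<beta> ^ 4 * ((a - b) * (a - c) * (b - c))\<^sup>2"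
    unfolding d e f by algebra
  then have "(a - b) * (a - c) * (b - c) \<noteq> 0" using assms(2) by auto
  then show ?thesis by (intro that[of a b c, OF _ _ _ e f d]) auto
qed

text \<open>Here \<alpha>\<delta> - \<beta>\<gamma> = \<beta>^2 W and the denominator is \<beta>^4
  V^2, so the quotient is -W^2 / V^2. The last hypothesis says that the inverse sum is
  \<open>s\<close>.\<close>

lemma infinity_spectrum_in_char_curve:
  fixes a b c \<beta> s :: complex
  defines "\<alpha> \<equiv> \<beta> * (a * b + a * c + b * c)" and "\<gamma> \<equiv> \<beta> * (a * b * c)" and "\<delta> \<equiv> \<beta> * (a + b + c)"
  assumes "a \<noteq> b" "a \<noteq> c" "b \<noteq> c" "\<beta> \<noteq> 0"
    and "\<alpha> * \<delta> - \<beta> * \<gamma> \<noteq> 0" "\<alpha> * \<delta> - 9 * (\<beta> * \<gamma>) = s * (\<alpha> * \<delta> - \<beta> * \<gamma>)"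
  shows "infinity_spectrum a b c \<in> char_curve s (- (\<alpha> * \<delta> - \<beta> * \<gamma>)\<^sup>2 /
    ((\<alpha> * \<delta>)\<^sup>2 + 18 * (\<alpha> * \<delta>) * (\<beta> * \<gamma>) - 27 * (\<beta> * \<gamma>)\<^sup>2 - 4 * (\<beta> * \<alpha> ^ 3 + \<gamma> * \<delta> ^ 3)))"
proof -
  define l where "l = infinity_spectrum a b c"
  define V W where "V = (a - b) * (a - c) * (b - c)" and "W = (a + b) * (a + c) * (b + c)"
  note sums = sum_char_numbers[OF assms(4-6), folded V_def W_def]
  have l: "l $ 1 + l $ 2 + l $ 3 = 1" "l $ 1 * l $ 2 * l $ 3 * V\<^sup>2 = - W\<^sup>2"
    "(l $ 1 * l $ 2 + l $ 1 * l $ 3 + l $ 2 * l $ 3) * W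
      = l $ 1 * l $ 2 * l $ 3 * ((a + b + c) * (a * b + a * c + b * c) - 9 * (a * b * c))"
    using sums by (simp_all add: l_def infinity_spectrum_def)
  have D: "\<alpha> * \<delta> - \<beta> * \<gamma> = \<beta>\<^sup>2 * W" unfolding \<alpha>_def \<gamma>_def \<delta>_def W_def by algebra
  have disc: "(\<alpha> * \<delta>)\<^sup>2 + 18 * (\<alpha> * \<delta>) * (\<beta> * \<gamma>) - 27 * (\<beta> * \<gamma>)\<^sup>2 - 4 * (\<beta> * \<alpha> ^ 3 + \<gamma> * \<delta> ^ 3)
      = \<beta> ^ 4 * V\<^sup>2" unfolding \<alpha>_def \<gamma>_def \<delta>_def V_def by algebra
  have "\<beta>\<^sup>2 * ((a + b + c) * (a * b + a * c + b * c) - 9 * (a * b * c)) = \<beta>\<^sup>2 * (s * W)"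
    using assms(9) unfolding D unfolding \<alpha>_def \<gamma>_def \<delta>_def by algebra
  then have s: "(a + b + c) * (a * b + a * c + b * c) - 9 * (a * b * c) = s * W"
    using \<open>\<beta> \<noteq> 0\<close> by simp
  have "V \<noteq> 0" using assms(4-6) by (simp add: V_def)
  moreover have "W \<noteq> 0" using assms(8) unfolding D by auto
  ultimately have m: "l $ 1 * l $ 2 * l $ 3 = - (\<beta>\<^sup>2 * W)\<^sup>2 / (\<beta> ^ 4 * V\<^sup>2)"
    using l(2) \<open>\<beta> \<noteq> 0\<close> by (simp add: field_simps power2_eq_square power4_eq_xxxx)
  have "l $ 1 * l $ 2 + l $ 1 * l $ 3 + l $ 2 * l $ 3 = s * (l $ 1 * l $ 2 * l $ 3)"
    using l(3) \<open>W \<noteq> 0\<close> unfolding s by (simp add: mult.assoc[symmetric] mult.commute[of _ W])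
  then show ?thesis
    unfolding disc D l_def[symmetric] using l(1) m by (simp add: char_curve_def)
qed

section \<open>Finite singularities with prescribed determinants\<close>

text \<open>The functional sending g to the sum of c_k g(u_k) kills polynomials of degree at most 2;
  it is applied to (x - u3)(x - u4). If f is the monic quartic with roots u_k, the conclusion means
  that c_k f'(u_k) is independent of k. The weights will be 1 / d_k.\<close>

lemma weights_times_derivative:
  fixes c1 c2 c3 c4 u1 u2 u3 u4 :: complex
  assumes "c1 + c2 + c3 + c4 = 0" "c1 * u1 + c2 * u2 + c3 * u3 + c4 * u4 = 0"
    "c1 * u1\<^sup>2 + c2 * u2\<^sup>2 + c3 * u3\<^sup>2 + c4 * u4\<^sup>2 = 0"
  shows "c1 * ((u1 - u2) * (u1 - u3) * (u1 - u4)) = c2 * ((u2 - u1) * (u2 - u3) * (u2 - u4))"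
proof -
  have "c1 * ((u1 - u3) * (u1 - u4)) + c2 * ((u2 - u3) * (u2 - u4)) =
    (c1 * u1\<^sup>2 + c2 * u2\<^sup>2 + c3 * u3\<^sup>2 + c4 * u4\<^sup>2)
    - (u3 + u4) * (c1 * u1 + c2 * u2 + c3 * u3 + c4 * u4) + u3 * u4 * (c1 + c2 + c3 + c4)"
    by algebra
  then have "c1 * ((u1 - u3) * (u1 - u4)) + c2 * ((u2 - u3) * (u2 - u4)) = 0"
    unfolding assms by simp
  then show ?thesis by algebra
qed

text \<open>After merging \<open>u1 = u2\<close> into a point of weight \<open>c1 + c2\<close>, the
  same functional is applied to quadratics vanishing at two of the three remaining points.\<close>

lemma weights_distinct:
  fixes c1 c2 c3 c4 u1 u2 u3 u4 :: complex
  assumes c: "c1 + c2 + c3 + c4 = 0" "c1 * u1 + c2 * u2 + c3 * u3 + c4 * u4 = 0"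
    "c1 * u1\<^sup>2 + c2 * u2\<^sup>2 + c3 * u3\<^sup>2 + c4 * u4\<^sup>2 = 0"
    and nz: "c3 \<noteq> 0" "c4 \<noteq> 0" "c1 + c2 \<noteq> 0"
    and "u1 = u2"
  shows "u1 = u2 \<and> u1 = u3 \<and> u1 = u4"
proof -
  have "c3 * ((u3 - u1) * (u3 - u4)) = 0" "c4 * ((u4 - u1) * (u4 - u3)) = 0"
    "(c1 + c2) * ((u1 - u3) * (u1 - u4)) = 0"
    using c \<open>u1 = u2\<close> by algebra+
  then have "u3 = u1 \<or> u3 = u4" "u4 = u1 \<or> u3 = u4" "u1 = u3 \<or> u1 = u4"
    using nz by auto
  then show ?thesis using \<open>u1 = u2\<close> by auto
qed

text \<open>Sum 0 and third elementary symmetric function 1 match the quartic (x^2 - \<kappa>)^2 - x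
  - \<mu>. The weighted conditions are invariant under affine maps since the weights have sum 0, so
  a solution containing 1 and 0 is found and then translated and scaled.\<close>

lemma exists_normalized_quadruple:
  fixes c1 c2 c3 c4 :: complex
  assumes c: "c1 + c2 + c3 + c4 = 0"
    and nz: "c1 \<noteq> 0" "c2 \<noteq> 0" "c3 \<noteq> 0" "c4 \<noteq> 0"
    and gen: "c1 + c2 \<noteq> 0" "c1 + c3 \<noteq> 0" "c2 + c3 \<noteq> 0"
  shows "\<exists>u1 u2 u3 u4. distinct [u1, u2, u3, u4] \<and> u1 + u2 + u3 + u4 = 0 \<and>
    u1 * u2 * u3 + u1 * u2 * u4 + u1 * u3 * u4 + u2 * u3 * u4 = 1 \<and>
    c1 * u1 + c2 * u2 + c3 * u3 + c4 * u4 = 0 \<and>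
    c1 * u1\<^sup>2 + c2 * u2\<^sup>2 + c3 * u3\<^sup>2 + c4 * u4\<^sup>2 = 0"
proof -
  \<comment> \<open>With y3 = 1 and y4 = 0, eliminating y2 leaves a quadratic equation for y1 with
    discriminant 4 c1 c2 c3 c4.\<close>
  define r where "r = csqrt (c1 * c2 * c3 * c4)"
  have r: "r\<^sup>2 = c1 * c2 * c3 * c4" by (simp add: r_def)
  define y1 y2 where "y1 = (r - c1 * c3) / (c1 * (c1 + c2))" and "y2 = - (c3 + c1 * y1) / c2"
  have y1: "c1 * (c1 + c2) * y1 = r - c1 * c3" using nz gen by (simp add: y1_def)
  have y2: "c2 * y2 = - (c3 + c1 * y1)" using nz by (simp add: y2_def)
  have lin: "c1 * y1 + c2 * y2 + c3 = 0" using y2 by simp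
  have quad: "c1 * y1\<^sup>2 + c2 * y2\<^sup>2 + c3 = 0"
  proof -
    have "c1 * (c1 + c2) * (c2 * (c1 * y1\<^sup>2 + c2 * y2\<^sup>2 + c3))
        = c1 * (c1 + c2) * (c1 * c2 * y1\<^sup>2 + (c2 * y2)\<^sup>2 + c2 * c3)" by algebra
    also have "\<dots> = (c1 * (c1 + c2) * y1 + c1 * c3)\<^sup>2 + c1 * c2 * c3 * (c1 + c2 + c3)"
      unfolding y2 by algebra
    also have "\<dots> = r\<^sup>2 + c1 * c2 * c3 * (c1 + c2 + c3)" unfolding y1 by simp
    also have "\<dots> = c1 * c2 * c3 * (c1 + c2 + c3 + c4)" unfolding r by algebra
    finally show ?thesis using c nz gen by simp
  qed
  have c4: "c4 = - (c1 + c2 + c3)" using c by algebra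
  have shift: "c1 * (y1 - s) + c2 * (y2 - s) + c3 * (1 - s) + c4 * (0 - s) = 0"
    "c1 * (y1 - s)\<^sup>2 + c2 * (y2 - s)\<^sup>2 + c3 * (1 - s)\<^sup>2 + c4 * (0 - s)\<^sup>2 = 0" for s
    using lin quad unfolding c4 by algebra+
  define s where "s = (y1 + y2 + 1) / 4"
  define z1 z2 z3 z4 where z: "z1 = y1 - s" "z2 = y2 - s" "z3 = 1 - s" "z4 = 0 - s"
  have s1: "c1 * z1 + c2 * z2 + c3 * z3 + c4 * z4 = 0"
    and s2: "c1 * z1\<^sup>2 + c2 * z2\<^sup>2 + c3 * z3\<^sup>2 + c4 * z4\<^sup>2 = 0" unfolding z by (fact shift)+
  have s0: "z1 + z2 + z3 + z4 = 0"
  proof -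
    have "4 * s = y1 + y2 + 1" by (simp add: s_def)
    then show ?thesis unfolding z by algebra
  qed
  have "z3 \<noteq> z4" by (simp add: z)
  have gen': "c1 + c4 \<noteq> 0" "c2 + c4 \<noteq> 0"
  proof -
    have "c1 + c4 = - (c2 + c3)" "c2 + c4 = - (c1 + c3)" unfolding c4 by simp_all
    then show "c1 + c4 \<noteq> 0" "c2 + c4 \<noteq> 0"
      using gen by (simp_all only: neg_equal_0_iff_equal not_False_eq_True)
  qed
  have ne: "x1 \<noteq> x2" if "b1 + b2 + b3 + b4 = 0" "b1 * x1 + b2 * x2 + b3 * x3 + b4 * x4 = 0"
      "b1 * x1\<^sup>2 + b2 * x2\<^sup>2 + b3 * x3\<^sup>2 + b4 * x4\<^sup>2 = 0"
      "b3 \<noteq> 0" "b4 \<noteq> 0" "b1 + b2 \<noteq> 0" "\<not> (x1 = x2 \<and> x1 = x3 \<and> x1 = x4)"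
    for b1 b2 b3 b4 x1 x2 x3 x4 :: complex
    using weights_distinct[OF that(1-6)] that(7) by blast
  have "z1 \<noteq> z2"
    by (rule ne[OF c s1 s2 nz(3,4) gen(1)]) (use \<open>z3 \<noteq> z4\<close> in blast)
  moreover have "z1 \<noteq> z3"
    by (rule ne[OF _ _ _ nz(2,4) gen(2), of z1 z3 z2 z4])
      (use c s1 s2 \<open>z3 \<noteq> z4\<close> in \<open>simp_all add: add.commute add.left_commute\<close>)
  moreover have "z1 \<noteq> z4"
    by (rule ne[OF _ _ _ nz(2,3) gen'(1), of z1 z4 z2 z3])
      (use c s1 s2 \<open>z3 \<noteq> z4\<close> in \<open>simp_all add: add.commute add.left_commute\<close>)
  moreover have "z2 \<noteq> z3"
    by (rule ne[OF _ _ _ nz(1,4) gen(3), of z2 z3 z1 z4])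
      (use c s1 s2 \<open>z3 \<noteq> z4\<close> in \<open>simp_all add: add.commute add.left_commute\<close>)
  moreover have "z2 \<noteq> z4"
    by (rule ne[OF _ _ _ nz(1,3) gen'(2), of z2 z4 z1 z3])
      (use c s1 s2 \<open>z3 \<noteq> z4\<close> in \<open>simp_all add: add.commute add.left_commute\<close>)
  ultimately have dist: "distinct [z1, z2, z3, z4]" using \<open>z3 \<noteq> z4\<close> by simp
  define e where "e = z1 * z2 * z3 + z1 * z2 * z4 + z1 * z3 * z4 + z2 * z3 * z4"
  \<comment> \<open>For opposite pairs, (x - x3)(x - x4) = x^2 - x3^2 takes the same value at x1 and
    x2, and the functional leaves (b1 + b2) times this value.\<close>
  have opp: False if "x1 + x2 = 0" "x3 + x4 = 0" "distinct [x1, x2, x3, x4]" "b1 + b2 \<noteq> 0"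
    "b1 + b2 + b3 + b4 = 0" "b1 * x1\<^sup>2 + b2 * x2\<^sup>2 + b3 * x3\<^sup>2 + b4 * x4\<^sup>2 = 0"
    for x1 x2 x3 x4 b1 b2 b3 b4 :: complex
  proof -
    have "(b1 + b2) * ((x1 - x3) * (x1 - x4)) = 0" using that(1,2,5,6) by algebra
    then show False using that by auto
  qed
  have "e = - ((z1 + z2) * (z1 + z3) * (z2 + z3))"
    using s0 unfolding e_def by algebra
  moreover have "z1 + z2 \<noteq> 0"
  proof
    assume "z1 + z2 = 0"
    moreover from this have "z3 + z4 = 0" using s0 by simp
    ultimately show False using opp[OF _ _ dist gen(1) c s2] by simp
  qed
  moreover have "z1 + z3 \<noteq> 0"
  proof
    assume "z1 + z3 = 0"
    moreover from this have "z2 + z4 = 0" using s0 by algebra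
    ultimately show False
      by (rule opp[OF _ _ _ gen(2), where ?b3.0 = c2 and ?b4.0 = c4]) (use c s2 dist in \<open>auto simp: add.commute add.left_commute\<close>)
  qed
  moreover have "z2 + z3 \<noteq> 0"
  proof
    assume "z2 + z3 = 0"
    moreover from this have "z1 + z4 = 0" using s0 by algebra
    ultimately show False
      by (rule opp[OF _ _ _ gen(3), where ?b3.0 = c1 and ?b4.0 = c4]) (use c s2 dist in \<open>auto simp: add.commute add.left_commute\<close>)
  qed
  ultimately have "e \<noteq> 0" by simp
  then obtain q where q: "q ^ 3 = 1 / e" by (metis exists_complex_root zero_neq_numeral)
  have "q \<noteq> 0"
  proof
    assume "q = 0"
    with q have "1 / e = 0" by simp
    then show False using \<open>e \<noteq> 0\<close> by simp
  qed
  show ?thesis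
  proof (rule exI[of _ "q * z1"], rule exI[of _ "q * z2"], rule exI[of _ "q * z3"],
      rule exI[of _ "q * z4"], intro conjI)
    show "distinct [q * z1, q * z2, q * z3, q * z4]" using dist \<open>q \<noteq> 0\<close> by simp
    show "q * z1 + q * z2 + q * z3 + q * z4 = 0" using s0 by algebra
    have "q * z1 * (q * z2) * (q * z3) + q * z1 * (q * z2) * (q * z4) +
      q * z1 * (q * z3) * (q * z4) + q * z2 * (q * z3) * (q * z4) = q ^ 3 * e"
      unfolding e_def by algebra
    then show "q * z1 * (q * z2) * (q * z3) + q * z1 * (q * z2) * (q * z4) +
      q * z1 * (q * z3) * (q * z4) + q * z2 * (q * z3) * (q * z4) = 1"
      using q \<open>e \<noteq> 0\<close> by simp
    show "c1 * (q * z1) + c2 * (q * z2) + c3 * (q * z3) + c4 * (q * z4) = 0" using s1 by algebra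
    show "c1 * (q * z1)\<^sup>2 + c2 * (q * z2)\<^sup>2 + c3 * (q * z3)\<^sup>2 + c4 * (q * z4)\<^sup>2 = 0"
      using s2 by algebra
  qed
qed

text \<open>Newton interpolation at three points. The weights annihilate both \<open>t\<close> and
  every quadratic polynomial, which forces the fourth value because \<open>c4\<close> is
  nonzero.\<close>

lemma interpolate_quadratic:
  fixes c1 c2 c3 c4 u1 u2 u3 u4 :: complex
  assumes "distinct [u1, u2, u3, u4]" and "c4 \<noteq> 0"
    and "c1 + c2 + c3 + c4 = 0" "c1 * u1 + c2 * u2 + c3 * u3 + c4 * u4 = 0"
    "c1 * u1\<^sup>2 + c2 * u2\<^sup>2 + c3 * u3\<^sup>2 + c4 * u4\<^sup>2 = 0"
    and "c1 * t1 + c2 * t2 + c3 * t3 + c4 * t4 = 0"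
  shows "\<exists>p q r. t1 = p + q * u1 + r * u1\<^sup>2 \<and> t2 = p + q * u2 + r * u2\<^sup>2 \<and>
    t3 = p + q * u3 + r * u3\<^sup>2 \<and> t4 = p + q * u4 + r * u4\<^sup>2"
proof -
  have d: "u2 - u1 \<noteq> 0" "u3 - u1 \<noteq> 0" "u3 - u2 \<noteq> 0" using assms(1) by auto
  define A B where "A = (t2 - t1) / (u2 - u1)" and "B = (t3 - t1) / (u3 - u1)"
  have A: "(u2 - u1) * A = t2 - t1" and B: "(u3 - u1) * B = t3 - t1"
    using d by (simp_all add: A_def B_def)
  define r where "r = (B - A) / (u3 - u2)"
  have r: "(u3 - u2) * r = B - A" using d by (simp add: r_def)
  define q where "q = A - r * (u1 + u2)"
  define p where "p = t1 - u1 * A + r * (u1 * u2)"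
  have L: "p + q * x + r * x\<^sup>2 = t1 + (x - u1) * A + (x - u1) * ((x - u2) * r)" for x
    unfolding p_def q_def by algebra
  have 1: "p + q * u1 + r * u1\<^sup>2 = t1" and 2: "p + q * u2 + r * u2\<^sup>2 = t2"
    unfolding L A by simp_all
  have "(u3 - u1) * A + (u3 - u1) * ((u3 - u2) * r) = (u3 - u1) * B"
    unfolding r by algebra
  then have 3: "p + q * u3 + r * u3\<^sup>2 = t3"
    unfolding L by (simp only: add.assoc B) simp
  have "c4 * (t4 - (p + q * u4 + r * u4\<^sup>2)) = 0"
    using assms(3-6) unfolding 1[symmetric] 2[symmetric] 3[symmetric] by algebra
  then have "t4 = p + q * u4 + r * u4\<^sup>2" using \<open>c4 \<noteq> 0\<close> by simp
  then show ?thesis using 1 2 3 by metis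
qed

section \<open>Relations on a family of twins\<close>

text \<open>The factor is \<open>poly_eval h l\<close> times the number of enumerations equal to
  \<open>l\<close>, which exceeds 1 when entries coincide.\<close>

lemma symmetrized_separated:
  assumes "poly_eval h l \<noteq> 0"
    and "\<And>i j k. vector [l $ i, l $ j, l $ k] \<noteq> l \<Longrightarrow> poly_eval h (vector [l $ i, l $ j, l $ k]) = 0"
  shows "\<exists>n. n \<noteq> 0 \<and> (\<forall>f. symmetrized (f * h) l = n * poly_eval f l)"
proof -
  define e where "e x = (if x = l then 1 else 0 :: nat)" for x
  define n where "n = e (vector [l $ 1, l $ 2, l $ 3]) + e (vector [l $ 1, l $ 3, l $ 2])
    + e (vector [l $ 2, l $ 1, l $ 3]) + e (vector [l $ 2, l $ 3, l $ 1])
    + e (vector [l $ 3, l $ 1, l $ 2]) + e (vector [l $ 3, l $ 2, l $ 1])"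
  have "vector [l $ 1, l $ 2, l $ 3] = l" by (simp add: vec_eq_iff forall_3)
  then have "n \<noteq> 0" by (simp add: n_def e_def)
  have x: "poly_eval (f * h) (vector [l $ i, l $ j, l $ k])
      = of_nat (e (vector [l $ i, l $ j, l $ k])) * (poly_eval f l * poly_eval h l)" for f i j k
    using assms(2)[of i j k] by (cases "vector [l $ i, l $ j, l $ k] = l") (auto simp: e_def)
  have "symmetrized (f * h) l = (of_nat n * poly_eval h l) * poly_eval f l" for f
    unfolding symmetrized_def x n_def of_nat_add by (simp add: distrib_right distrib_left ac_simps)
  then show ?thesis
    using \<open>n \<noteq> 0\<close> assms(1) by (intro exI[of _ "of_nat n * poly_eval h l"]) simp
qed

text \<open>\<open>p / q\<close> and \<open>pr / qr\<close> represent R and r. X and Y are the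
  values of \<alpha>\<delta> and \<beta>\<gamma>, so \<open>X \<noteq> Y\<close> makes M invertible,
  and the last condition makes \<open>s\<close> the inverse sum.\<close>

locale spectrum_relation =
  fixes p q :: "8 cpoly" and pr qr :: "3 cpoly" and u :: "complex ^ 4" and X Y s :: complex
  assumes relation: "\<And>v t d l. nondegenerate v \<Longrightarrow> extended_spectrum v t d l \<Longrightarrow>
      poly_eval q (join t d) \<noteq> 0 \<Longrightarrow> poly_eval qr l \<noteq> 0 \<Longrightarrow>
      poly_eval p (join t d) * poly_eval qr l = poly_eval q (join t d) * poly_eval pr l"
    and u_inj: "inj (($) u)"
    and u_sum: "u $ 1 + u $ 2 + u $ 3 + u $ 4 = 0"
    and u_e3: "u $ 1 * u $ 2 * u $ 3 + u $ 1 * u $ 2 * u $ 4 + u $ 1 * u $ 3 * u $ 4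
      + u $ 2 * u $ 3 * u $ 4 = 1"
    and XY: "X \<noteq> 0" "Y \<noteq> 0" "X \<noteq> Y" "X - 9 * Y = s * (X - Y)"
begin

definition "\<kappa> = - (u $ 1 * u $ 2 + u $ 1 * u $ 3 + u $ 1 * u $ 4 + u $ 2 * u $ 3 + u $ 2 * u $ 4
  + u $ 3 * u $ 4) / 2"

text \<open>The normal form has \<open>\<delta> = X / \<alpha>\<close>, \<open>\<gamma> = Y / \<beta>\<close>, and the \<open>u\<^sub>k\<close> are the abscissae of its singular
  points. Only \<open>\<alpha>\<close> and \<open>\<beta>\<close> vary, so that the determinants and the sum of the inverse
  characteristic numbers stay constant. The product of the characteristic numbers is
  \<open>- (X - Y)\<^sup>2 / discr \<alpha> \<beta>\<close>, where \<open>discr\<close> is the discriminant of the cubic form at infinity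
  \<open>\<beta> w\<^sup>3 - \<delta> w\<^sup>2 + \<alpha> w - \<gamma>\<close>.\<close>

definition traces :: "complex \<Rightarrow> complex \<Rightarrow> complex ^ 4" where
  "traces \<alpha> \<beta> = (\<chi> k. 2 * \<alpha> * u $ k + 2 * (X / \<alpha>) * ((u $ k)\<^sup>2 - \<kappa>) - (\<beta> + Y / \<beta>))"

definition dets :: "complex ^ 4" where
  "dets = (\<chi> k. (X - Y) * (4 * u $ k * ((u $ k)\<^sup>2 - \<kappa>) - 1))"

definition discr :: "complex \<Rightarrow> complex \<Rightarrow> complex" where
  "discr \<alpha> \<beta> = X\<^sup>2 + 18 * X * Y - 27 * Y\<^sup>2 - 4 * (\<beta> * \<alpha> ^ 3 + Y / \<beta> * (X / \<alpha>) ^ 3)"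

abbreviation "val f \<alpha> \<beta> \<equiv> poly_eval f (join (traces \<alpha> \<beta>) dets)"

text \<open>Comparing coefficients with x^4 - 2\<kappa> x^2 - x + \<kappa>^2 - \<mu> explains the
  choice of \<kappa> and gives \<mu> as \<kappa>^2 minus the product of the u_k.\<close>

lemma quartic_roots:
  "\<exists>\<mu>. \<forall>x. (x\<^sup>2 - \<kappa>)\<^sup>2 - x - \<mu> = 0 \<longleftrightarrow> x \<in> range (($) u)"
proof -
  have k: "2 * \<kappa> = - (u $ 1 * u $ 2 + u $ 1 * u $ 3 + u $ 1 * u $ 4 + u $ 2 * u $ 3 + u $ 2 * u $ 4
    + u $ 3 * u $ 4)" by (simp add: \<kappa>_def)
  have "(x\<^sup>2 - \<kappa>)\<^sup>2 - x - (\<kappa>\<^sup>2 - u $ 1 * u $ 2 * u $ 3 * u $ 4)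
      = (x - u $ 1) * (x - u $ 2) * (x - u $ 3) * (x - u $ 4)" for x
  proof -
    have "(x - u $ 1) * (x - u $ 2) * (x - u $ 3) * (x - u $ 4)
      = x ^ 4 - (u $ 1 + u $ 2 + u $ 3 + u $ 4) * x ^ 3
        + (u $ 1 * u $ 2 + u $ 1 * u $ 3 + u $ 1 * u $ 4 + u $ 2 * u $ 3 + u $ 2 * u $ 4 + u $ 3 * u $ 4) * x\<^sup>2
        - (u $ 1 * u $ 2 * u $ 3 + u $ 1 * u $ 2 * u $ 4 + u $ 1 * u $ 3 * u $ 4 + u $ 2 * u $ 3 * u $ 4) * x
        + u $ 1 * u $ 2 * u $ 3 * u $ 4" by algebra
    also have "\<dots> = x ^ 4 - 2 * \<kappa> * x\<^sup>2 - x + u $ 1 * u $ 2 * u $ 3 * u $ 4"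
      unfolding u_sum u_e3 k by algebra
    finally show ?thesis by algebra
  qed
  moreover have "range (($) u) = {u $ 1, u $ 2, u $ 3, u $ 4}" by (auto simp: UNIV_4)
  ultimately show ?thesis
    by (intro exI[of _ "\<kappa>\<^sup>2 - u $ 1 * u $ 2 * u $ 3 * u $ 4"]) auto
qed

lemma symmetrized_relation:
  assumes "\<alpha> \<noteq> 0" "\<beta> \<noteq> 0" and disc: "discr \<alpha> \<beta> \<noteq> 0" and q: "val q \<alpha> \<beta> \<noteq> 0"
  obtains l where "l \<in> char_curve s (- (X - Y)\<^sup>2 / discr \<alpha> \<beta>)"
    "\<And>h. val p \<alpha> \<beta> * symmetrized (qr * qr * h) l = val q \<alpha> \<beta> * symmetrized (pr * qr * h) l"
proof -
  define \<gamma> \<delta> where "\<gamma> = Y / \<beta>" and "\<delta> = X / \<alpha>"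
  have X: "\<alpha> * \<delta> = X" and Y: "\<beta> * \<gamma> = Y" using assms by (simp_all add: \<gamma>_def \<delta>_def)
  have disc': "discr \<alpha> \<beta> = (\<alpha> * \<delta>)\<^sup>2 + 18 * (\<alpha> * \<delta>) * (\<beta> * \<gamma>) - 27 * (\<beta> * \<gamma>)\<^sup>2
      - 4 * (\<beta> * \<alpha> ^ 3 + \<gamma> * \<delta> ^ 3)"
    unfolding X Y by (simp add: discr_def \<gamma>_def \<delta>_def)
  obtain a b c where abc: "a \<noteq> b" "a \<noteq> c" "b \<noteq> c"
    and coeffs: "\<alpha> = \<beta> * (a * b + a * c + b * c)" "\<gamma> = \<beta> * (a * b * c)" "\<delta> = \<beta> * (a + b + c)"
    using cubic_with_distinct_roots[OF \<open>\<beta> \<noteq> 0\<close>] disc unfolding disc' by metis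
  obtain \<mu> where \<mu>: "\<And>x. (x\<^sup>2 - \<kappa>)\<^sup>2 - x - \<mu> = 0 \<longleftrightarrow> x \<in> range (($) u)" using quartic_roots by blast
  have rel: "val p \<alpha> \<beta> * poly_eval qr (infinity_spectrum x y z)
      = val q \<alpha> \<beta> * poly_eval pr (infinity_spectrum x y z)"
    if xyz: "x \<noteq> y" "x \<noteq> z" "y \<noteq> z" "x * y + x * z + y * z = a * b + a * c + b * c" "x * y * z = a * b * c"
      "x + y + z = a + b + c" and qr: "poly_eval qr (infinity_spectrum x y z) \<noteq> 0" for x y z
  proof -
    have coeffs': "\<beta> * (x * y + x * z + y * z) = \<alpha>" "\<beta> * (x * y * z) = \<gamma>" "\<beta> * (x + y + z) = \<delta>"
      unfolding xyz(4-6) by (simp_all add: coeffs)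
    note spec = normal_field_spectrum[OF \<open>\<beta> \<noteq> 0\<close> xyz(1-3) _ u_inj \<mu>, unfolded coeffs' X Y]
    have "X - Y \<noteq> 0" using XY by simp
    moreover have "traces \<alpha> \<beta> = (\<chi> k. 2 * \<alpha> * u $ k + 2 * \<delta> * ((u $ k)\<^sup>2 - \<kappa>) - (\<beta> + \<gamma>))"
      by (simp add: traces_def \<gamma>_def \<delta>_def)
    ultimately show ?thesis
      using relation[OF spec(1) spec(2)] q qr unfolding dets_def by simp
  qed
  define l where "l = infinity_spectrum a b c"
  have perm: "vector [l $ 1, l $ 2, l $ 3] = infinity_spectrum a b c"
    "vector [l $ 1, l $ 3, l $ 2] = infinity_spectrum a c b"
    "vector [l $ 2, l $ 1, l $ 3] = infinity_spectrum b a c"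
    "vector [l $ 2, l $ 3, l $ 1] = infinity_spectrum b c a"
    "vector [l $ 3, l $ 1, l $ 2] = infinity_spectrum c a b"
    "vector [l $ 3, l $ 2, l $ 1] = infinity_spectrum c b a"
    by (simp_all add: l_def infinity_spectrum_def mult.commute add.commute)
  have rel': "val p \<alpha> \<beta> * poly_eval (qr * qr * h) (infinity_spectrum x y z)
      = val q \<alpha> \<beta> * poly_eval (pr * qr * h) (infinity_spectrum x y z)"
    if xyz: "x \<noteq> y" "x \<noteq> z" "y \<noteq> z" "x * y + x * z + y * z = a * b + a * c + b * c" "x * y * z = a * b * c"
      "x + y + z = a + b + c" for x y z h
  proof (cases "poly_eval qr (infinity_spectrum x y z) = 0")
    case False
    then show ?thesis using rel[OF xyz] by simp
  qed simp
  have "val p \<alpha> \<beta> * symmetrized (qr * qr * h) l = val q \<alpha> \<beta> * symmetrized (pr * qr * h) l" for h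
  proof -
    let ?E = "\<lambda>x y z. val p \<alpha> \<beta> * poly_eval (qr * qr * h) (infinity_spectrum x y z)
      = val q \<alpha> \<beta> * poly_eval (pr * qr * h) (infinity_spectrum x y z)"
    have "?E a b c" "?E a c b" "?E b a c" "?E b c a" "?E c a b" "?E c b a"
      by (rule rel'; use abc in \<open>simp add: mult.commute mult.left_commute add.commute add.left_commute\<close>)+
    then show ?thesis unfolding symmetrized_def perm distrib_left by (simp only:)
  qed
  moreover have "l \<in> char_curve s (- (X - Y)\<^sup>2 / discr \<alpha> \<beta>)"
    using infinity_spectrum_in_char_curve[OF abc \<open>\<beta> \<noteq> 0\<close>, folded coeffs, of s] XY
    unfolding disc' X Y l_def by simp
  ultimately show ?thesis by (intro that)
qed

lemma traces_twin: "\<beta> \<noteq> 0 \<Longrightarrow> traces \<alpha> (Y / \<beta>) = traces \<alpha> \<beta>"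
  using XY by (simp add: traces_def add.commute)

lemma holomorphic_val:
  assumes "f holomorphic_on UNIV" "g holomorphic_on UNIV" "\<And>z. f z \<noteq> 0" "\<And>z. g z \<noteq> 0"
  shows "(\<lambda>z. val r (f z) (g z)) holomorphic_on UNIV"
proof (intro holomorphic_on_poly_eval holomorphic_on_join)
  show "(\<lambda>z. traces (f z) (g z) $ i) holomorphic_on UNIV" for i
    unfolding traces_def vec_lambda_beta using assms by (intro holomorphic_intros) auto
qed simp

text \<open>Twins with products \<open>m\<close> and \<open>m'\<close> share the value of R;
  eliminating it shows that B / A agrees at \<open>m\<close> and \<open>m'\<close>. As
  \<open>q\<close> may vanish at these twins, they are approached along a curve through
  \<open>\<alpha>\<^sub>0\<close>, \<open>\<beta>\<^sub>0\<close>, where \<open>q\<close> does not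
  vanish.\<close>

lemma characteristic_numbers_separated:
  assumes "\<alpha>\<^sub>0 \<noteq> 0" "\<beta>\<^sub>0 \<noteq> 0" "val q \<alpha>\<^sub>0 \<beta>\<^sub>0 \<noteq> 0"
    and A: "\<And>m l. l \<in> char_curve s m \<Longrightarrow> symmetrized (qr * qr * h) l = poly A m"
    and B: "\<And>m l. l \<in> char_curve s m \<Longrightarrow> symmetrized (pr * qr * h) l = poly B m"
    and "m \<noteq> 0" "m' \<noteq> 0"
  shows "poly B m * poly A m' = poly A m * poly B m'"
proof -
  \<comment> \<open>The value of \<beta>\<alpha>^3 + \<gamma>\<delta>^3 for which the product of the
    characteristic numbers is x.\<close>
  define G where "G x = (X\<^sup>2 + 18 * X * Y - 27 * Y\<^sup>2 + (X - Y)\<^sup>2 / x) / 4" for x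
  obtain \<alpha>\<^sub>1 \<beta>\<^sub>1 where ab: "\<alpha>\<^sub>1 \<noteq> 0" "\<beta>\<^sub>1 \<noteq> 0" "\<beta>\<^sub>1 * \<alpha>\<^sub>1 ^ 3 + Y / \<beta>\<^sub>1 * (X / \<alpha>\<^sub>1) ^ 3 = G m"
      "Y / \<beta>\<^sub>1 * \<alpha>\<^sub>1 ^ 3 + \<beta>\<^sub>1 * (X / \<alpha>\<^sub>1) ^ 3 = G m'"
    using twin_parameters[OF XY(1,2)] by metis
  have G: "4 * G x = X\<^sup>2 + 18 * X * Y - 27 * Y\<^sup>2 + (X - Y)\<^sup>2 / x" for x by (simp add: G_def)
  have d1: "discr \<alpha>\<^sub>1 \<beta>\<^sub>1 = - (X - Y)\<^sup>2 / m" unfolding discr_def ab(3) G by simp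
  have "Y / (Y / \<beta>\<^sub>1) = \<beta>\<^sub>1" using XY(2) by simp
  then have d2: "discr \<alpha>\<^sub>1 (Y / \<beta>\<^sub>1) = - (X - Y)\<^sup>2 / m'"
    unfolding discr_def by (simp only: ab(4) G) simp
  have XY': "(X - Y)\<^sup>2 \<noteq> 0" using XY by simp
  have moment: "- (X - Y)\<^sup>2 / discr \<alpha>\<^sub>1 \<beta>\<^sub>1 = m" "- (X - Y)\<^sup>2 / discr \<alpha>\<^sub>1 (Y / \<beta>\<^sub>1) = m'"
    unfolding d1 d2 using XY' \<open>m \<noteq> 0\<close> \<open>m' \<noteq> 0\<close> by simp_all
  \<comment> \<open>Exponentials give entire curves avoiding 0, from the twins at z = 0 to the point
    with \<open>q\<close> nonzero at z = 1.\<close>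
  define f where "f z = exp (Ln \<alpha>\<^sub>1 + z * (Ln \<alpha>\<^sub>0 - Ln \<alpha>\<^sub>1))" for z
  define g where "g z = exp (Ln \<beta>\<^sub>1 + z * (Ln \<beta>\<^sub>0 - Ln \<beta>\<^sub>1))" for z
  have fg: "f 0 = \<alpha>\<^sub>1" "f 1 = \<alpha>\<^sub>0" "g 0 = \<beta>\<^sub>1" "g 1 = \<beta>\<^sub>0" "\<And>z. f z \<noteq> 0" "\<And>z. g z \<noteq> 0"
    using ab(1,2) assms(1,2) by (simp_all add: f_def g_def)
  have hol: "f holomorphic_on UNIV" "g holomorphic_on UNIV"
    unfolding f_def g_def by (intro holomorphic_intros)+
  have lim: "(f \<longlongrightarrow> \<alpha>\<^sub>1) (at 0)" "(g \<longlongrightarrow> \<beta>\<^sub>1) (at 0)"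
    using hol fg(1,3) by (auto dest!: holomorphic_on_imp_continuous_on
        simp: continuous_on_eq_continuous_at isCont_def)
  define M M' where "M z = - (X - Y)\<^sup>2 / discr (f z) (g z)"
    and "M' z = - (X - Y)\<^sup>2 / discr (f z) (Y / g z)" for z
  have lim_d: "((\<lambda>z. discr (f z) (g z)) \<longlongrightarrow> discr \<alpha>\<^sub>1 \<beta>\<^sub>1) (at 0)"
    "((\<lambda>z. discr (f z) (Y / g z)) \<longlongrightarrow> discr \<alpha>\<^sub>1 (Y / \<beta>\<^sub>1)) (at 0)"
    unfolding discr_def using ab(1,2) XY(2) by (intro tendsto_intros lim; simp)+
  have nz: "discr \<alpha>\<^sub>1 \<beta>\<^sub>1 \<noteq> 0" "discr \<alpha>\<^sub>1 (Y / \<beta>\<^sub>1) \<noteq> 0"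
    unfolding d1 d2 using XY' \<open>m \<noteq> 0\<close> \<open>m' \<noteq> 0\<close> by simp_all
  have lim_M: "(M \<longlongrightarrow> m) (at 0)" "(M' \<longlongrightarrow> m') (at 0)"
    unfolding M_def M'_def using tendsto_divide[OF tendsto_const lim_d(1) nz(1), of "- (X - Y)\<^sup>2"]
      tendsto_divide[OF tendsto_const lim_d(2) nz(2), of "- (X - Y)\<^sup>2"] by (simp_all only: moment)
  have "\<forall>\<^sub>F z in at 0. val q (f z) (g z) \<noteq> 0"
    by (rule entire_eventually_nonzero[of _ 1]) (use holomorphic_val[OF hol] fg assms(3) in auto)
  moreover have "\<forall>\<^sub>F z in at 0. discr (f z) (g z) \<noteq> 0" "\<forall>\<^sub>F z in at 0. discr (f z) (Y / g z) \<noteq> 0"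
    using tendsto_imp_eventually_ne lim_d nz by blast+
  ultimately have "\<forall>\<^sub>F z in at 0. poly B (M z) * poly A (M' z) - poly A (M z) * poly B (M' z) = 0"
  proof eventually_elim
    case (elim z)
    obtain l where l: "l \<in> char_curve s (M z)"
        "val p (f z) (g z) * symmetrized (qr * qr * h) l = val q (f z) (g z) * symmetrized (pr * qr * h) l"
      using symmetrized_relation[OF fg(5,6) elim(2,1)] unfolding M_def by metis
    have tw: "traces (f z) (Y / g z) = traces (f z) (g z)" by (rule traces_twin) (rule fg)
    have "Y / g z \<noteq> 0" using XY fg by simp
    then obtain l' where l': "l' \<in> char_curve s (M' z)"
        "val p (f z) (g z) * symmetrized (qr * qr * h) l' = val q (f z) (g z) * symmetrized (pr * qr * h) l'"
      using symmetrized_relation[OF fg(5) _ elim(3), unfolded tw] elim(1) unfolding M'_def by metis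
    have "val p (f z) (g z) * poly A (M z) = val q (f z) (g z) * poly B (M z)"
      and "val p (f z) (g z) * poly A (M' z) = val q (f z) (g z) * poly B (M' z)"
      using l l' A B by simp_all
    then have "val q (f z) (g z) * (poly B (M z) * poly A (M' z) - poly A (M z) * poly B (M' z)) = 0"
      by algebra
    then show ?case using elim(1) by simp
  qed
  then have "((\<lambda>z. poly B (M z) * poly A (M' z) - poly A (M z) * poly B (M' z)) \<longlongrightarrow> 0) (at 0)"
    by (rule tendsto_eventually)
  moreover have "((\<lambda>z. poly B (M z) * poly A (M' z) - poly A (M z) * poly B (M' z))
      \<longlongrightarrow> poly B m * poly A m' - poly A m * poly B m') (at 0)"
    by (intro tendsto_intros lim_M)
  ultimately have "poly B m * poly A m' - poly A m * poly B m' = 0"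
    by (rule LIM_unique[rotated])
  then show ?thesis by simp
qed

text \<open>\<open>l\<close> need not belong to the field with parameters \<alpha>, \<beta>; only
  \<open>s\<close> is shared. If x is the product for that field, then R = B(x) / A(x) = B(m) / A(m)
  = r(l), the last equality by the choice of \<open>h\<close>. Varying \<beta> secures A(x) \<noteq>
  0.\<close>

proposition relation_on_char_curve:
  assumes "\<alpha> \<noteq> 0" "\<beta> \<noteq> 0" and q: "val q \<alpha> \<beta> \<noteq> 0"
    and l: "l \<in> char_curve s m" "m \<noteq> 0" and qr: "poly_eval qr l \<noteq> 0"
  shows "val p \<alpha> \<beta> * poly_eval qr l = val q \<alpha> \<beta> * poly_eval pr l"
proof -
  define Z where "Z = (\<lambda>(i, j, k). vector [l $ i, l $ j, l $ k] :: complex ^ 3) ` UNIV - {l}"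
  have "finite Z" "l \<notin> Z" unfolding Z_def by simp_all
  then obtain h where h: "poly_eval h l \<noteq> 0" "\<forall>z\<in>Z. poly_eval h z = 0"
    using exists_separating_cpoly by blast
  have "vector [l $ i, l $ j, l $ k] \<in> Z" if "vector [l $ i, l $ j, l $ k] \<noteq> l" for i j k
    unfolding Z_def using that by (auto simp: image_iff)
  then obtain n where n: "n \<noteq> 0" "\<And>f. symmetrized (f * h) l = n * poly_eval f l"
    using symmetrized_separated[OF h(1)] h(2) by metis
  obtain A where A: "\<And>m l. l \<in> char_curve s m \<Longrightarrow> symmetrized (qr * qr * h) l = poly A m"
    using symmetrized_poly by metis
  obtain B where B: "\<And>m l. l \<in> char_curve s m \<Longrightarrow> symmetrized (pr * qr * h) l = poly B m"
    using symmetrized_poly by metis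
  have Am: "poly A m = n * (poly_eval qr l * poly_eval qr l)"
    and Bm: "poly B m = n * (poly_eval pr l * poly_eval qr l)"
    using A[OF l(1)] B[OF l(1)] n(2) by simp_all
  have "poly A m \<noteq> 0" unfolding Am using n(1) qr by simp
  then have "finite {x. poly A x = 0}" by (metis poly_0 poly_roots_finite)
  \<comment> \<open>Values of \<open>discr\<close> to avoid: 0 and those giving a root of
    \<open>A\<close>. Product and discriminant determine each other by the same involution.\<close>
  define bad where "bad = insert 0 ((\<lambda>x. - (X - Y)\<^sup>2 / x) ` {x. poly A x = 0})"
  have "finite bad" unfolding bad_def using \<open>finite {x. poly A x = 0}\<close> by simp
  have good: "x \<noteq> 0" "poly A (- (X - Y)\<^sup>2 / x) \<noteq> 0" if "x \<notin> bad" for x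
  proof -
    show "x \<noteq> 0" using that by (auto simp: bad_def)
    show "poly A (- (X - Y)\<^sup>2 / x) \<noteq> 0"
    proof
      assume "poly A (- (X - Y)\<^sup>2 / x) = 0"
      then have "- (X - Y)\<^sup>2 / (- (X - Y)\<^sup>2 / x) \<in> bad" unfolding bad_def by blast
      then show False using that XY \<open>x \<noteq> 0\<close> by simp
    qed
  qed
  define g where "g z = \<beta> * exp z" for z
  have g: "g 0 = \<beta>" "\<And>z. g z \<noteq> 0" using \<open>\<beta> \<noteq> 0\<close> by (simp_all add: g_def)
  have hol: "g holomorphic_on UNIV" unfolding g_def by (intro holomorphic_intros)
  have lim: "(g \<longlongrightarrow> \<beta>) (at 0)"
    unfolding g_def by (auto intro!: tendsto_eq_intros)
  have "\<forall>\<^sub>F z in at 0. discr \<alpha> (g z) \<noteq> x" for x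
  proof -
    \<comment> \<open>In y = exp z the difference is k - c y - e / y; vanishing at y = 1, -1, 2
      would force c = 0.\<close>
    define c e where "c = 4 * \<beta> * \<alpha> ^ 3" and "e = 4 * (Y / \<beta> * (X / \<alpha>) ^ 3)"
    define k where "k = X\<^sup>2 + 18 * X * Y - 27 * Y\<^sup>2 - x"
    have ce: "c \<noteq> 0" using \<open>\<alpha> \<noteq> 0\<close> \<open>\<beta> \<noteq> 0\<close> by (simp add: c_def)
    have d: "discr \<alpha> (g z) - x = k - c * exp z - e / exp z" for z
      by (simp add: discr_def g_def k_def c_def e_def)
    have "\<exists>z. k - c * exp z - e / exp z \<noteq> 0"
    proof (rule ccontr)
      assume "\<nexists>z. k - c * exp z - e / exp z \<noteq> 0"
      then have "k - c * y - e / y = 0" if "y \<noteq> 0" for y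
        using that by (metis exp_Ln)
      from this[of 1] this[of "-1"] this[of 2] have "k - c - e = 0" "k + c + e = 0" "k - 2 * c - e / 2 = 0"
        by (simp_all add: mult.commute)
      then have "c = 0" by algebra
      then show False using ce by simp
    qed
    then obtain z0 where "k - c * exp z0 - e / exp z0 \<noteq> 0" by blast
    moreover have "(\<lambda>z. k - c * exp z - e / exp z) holomorphic_on UNIV"
      by (intro holomorphic_intros) auto
    ultimately have "\<forall>\<^sub>F z in at 0. k - c * exp z - e / exp z \<noteq> 0"
      by (intro entire_eventually_nonzero)
    then have "\<forall>\<^sub>F z in at 0. discr \<alpha> (g z) - x \<noteq> 0" unfolding d .
    then show ?thesis by simp
  qed
  then have "\<forall>\<^sub>F z in at 0. \<forall>x\<in>bad. discr \<alpha> (g z) \<noteq> x"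
    by (intro eventually_ball_finite \<open>finite bad\<close>) auto
  moreover have "\<forall>\<^sub>F z in at 0. val q \<alpha> (g z) \<noteq> 0"
    by (rule entire_eventually_nonzero[of _ 0]) (use holomorphic_val[of "\<lambda>_. \<alpha>"] g hol q \<open>\<alpha> \<noteq> 0\<close> in auto)
  ultimately have "\<forall>\<^sub>F z in at 0. val p \<alpha> (g z) * poly_eval qr l = val q \<alpha> (g z) * poly_eval pr l"
  proof eventually_elim
    case (elim z)
    define x where "x = - (X - Y)\<^sup>2 / discr \<alpha> (g z)"
    have disc: "discr \<alpha> (g z) \<noteq> 0" and Ax: "poly A x \<noteq> 0"
      unfolding x_def using elim(1) good by blast+
    have "x \<noteq> 0" unfolding x_def using disc XY by simp
    obtain l' where l': "l' \<in> char_curve s x"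
        "val p \<alpha> (g z) * symmetrized (qr * qr * h) l' = val q \<alpha> (g z) * symmetrized (pr * qr * h) l'"
      using symmetrized_relation[OF \<open>\<alpha> \<noteq> 0\<close> g(2) disc elim(2)] unfolding x_def by metis
    then have 1: "val p \<alpha> (g z) * poly A x = val q \<alpha> (g z) * poly B x"
      using A B by simp
    have "poly B x * poly A m = poly A x * poly B m"
      by (rule characteristic_numbers_separated[OF assms(1-3) A B \<open>x \<noteq> 0\<close> \<open>m \<noteq> 0\<close>])
    then have "(n * poly_eval qr l) * (poly B x * poly_eval qr l) = (n * poly_eval qr l) * (poly A x * poly_eval pr l)"
      unfolding Am Bm by (simp only: ac_simps)
    then have 2: "poly B x * poly_eval qr l = poly A x * poly_eval pr l"
      using n(1) qr by simp
    have "poly A x * (val p \<alpha> (g z) * poly_eval qr l) = poly A x * (val q \<alpha> (g z) * poly_eval pr l)"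
      using 1 2 by algebra
    then show ?case using Ax by simp
  qed
  then have "((\<lambda>z. val p \<alpha> (g z) * poly_eval qr l - val q \<alpha> (g z) * poly_eval pr l) \<longlongrightarrow> 0) (at 0)"
    by (intro tendsto_eventually) (auto elim: eventually_mono)
  moreover have "((\<lambda>z. traces \<alpha> (g z)) \<longlongrightarrow> traces \<alpha> \<beta>) (at 0)"
  proof (rule vec_tendstoI)
    show "((\<lambda>z. traces \<alpha> (g z) $ i) \<longlongrightarrow> traces \<alpha> \<beta> $ i) (at 0)" for i
      unfolding traces_def vec_lambda_beta using \<open>\<beta> \<noteq> 0\<close> by (intro tendsto_intros lim)
  qed
  then have "((\<lambda>z. val p \<alpha> (g z) * poly_eval qr l - val q \<alpha> (g z) * poly_eval pr l)
      \<longlongrightarrow> val p \<alpha> \<beta> * poly_eval qr l - val q \<alpha> \<beta> * poly_eval pr l) (at 0)"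
    by (intro tendsto_intros)
  ultimately have "val p \<alpha> \<beta> * poly_eval qr l - val q \<alpha> \<beta> * poly_eval pr l = 0"
    by (rule LIM_unique[rotated])
  then show ?thesis by simp
qed

end

section \<open>Deformation to generic points\<close>

text \<open>The two roots have product e / a; take the smaller one. The bound does not involve
  \<open>b\<close>, so the root tends to 0 as e / a does.\<close>

lemma small_quadratic_root:
  fixes a b e :: complex
  assumes "a \<noteq> 0"
  shows "\<exists>z. a * z\<^sup>2 + b * z + e = 0 \<and> (cmod z)\<^sup>2 \<le> cmod (e / a)"
proof -
  define B E where "B = b / a" and "E = e / a"
  define r where "r = csqrt (B\<^sup>2 - 4 * E)"
  define x y where "x = (- B + r) / 2" and "y = (- B - r) / 2"
  have "r\<^sup>2 = B\<^sup>2 - 4 * E" by (simp add: r_def)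
  then have "x * y = E" "x + y = - B"
    unfolding x_def y_def by (simp_all add: field_simps power2_eq_square)
  then have xy: "x * y = e / a" "x + y = - (b / a)" unfolding B_def E_def by simp_all
  have root: "a * z\<^sup>2 + b * z + e = a * ((z - x) * (z - y))" for z
  proof -
    have "a * ((z - x) * (z - y)) = a * z\<^sup>2 - a * (x + y) * z + a * (x * y)" by algebra
    then show ?thesis unfolding xy using assms by simp
  qed
  have cm: "cmod x * cmod y = cmod (e / a)" by (metis norm_mult xy(1))
  show ?thesis
  proof (cases "cmod x \<le> cmod y")
    case True
    then have "(cmod x)\<^sup>2 \<le> cmod (e / a)"
      unfolding cm[symmetric] power2_eq_square by (intro mult_left_mono) auto
    then show ?thesis using root by (intro exI[of _ x]) simp
  next
    case False
    then have "(cmod y)\<^sup>2 \<le> cmod (e / a)"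
      unfolding cm[symmetric] power2_eq_square by (intro mult_right_mono) auto
    then show ?thesis using root by (intro exI[of _ y]) simp
  qed
qed

text \<open>Changing coordinate \<open>i\<close> restores the linear condition; a step along \<eta>,
  which the linear form annihilates, then restores the quadratic one. The quadratic form at \<eta>
  is c_i c_j (c_i + c_j), nonzero in the limit, so \<open>small_quadratic_root\<close> gives a step
  tending to 0.\<close>

lemma deform_traces:
  fixes c :: "complex \<Rightarrow> 'n::finite \<Rightarrow> complex" and t\<^sub>0 :: "complex ^ 'n"
  assumes c: "\<And>k. ((\<lambda>z. c z k) \<longlongrightarrow> c\<^sub>0 k) (at 0)" and S: "(S \<longlongrightarrow> S\<^sub>0) (at 0)"
    and nz: "c\<^sub>0 i \<noteq> 0" "c\<^sub>0 j \<noteq> 0" "c\<^sub>0 i + c\<^sub>0 j \<noteq> 0" "i \<noteq> j"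
    and t\<^sub>0: "(\<Sum>k\<in>UNIV. c\<^sub>0 k * t\<^sub>0 $ k) = 0" "(\<Sum>k\<in>UNIV. c\<^sub>0 k * (t\<^sub>0 $ k)\<^sup>2) = S\<^sub>0"
  obtains t where "(t \<longlongrightarrow> t\<^sub>0) (at 0)"
    "\<forall>\<^sub>F z in at 0. (\<Sum>k\<in>UNIV. c z k * t z $ k) = 0 \<and> (\<Sum>k\<in>UNIV. c z k * (t z $ k)\<^sup>2) = S z"
proof -
  define y where "y z k = t\<^sub>0 $ k + (if k = i then - (\<Sum>k\<in>UNIV. c z k * t\<^sub>0 $ k) / c z i else 0)" for z k
  define \<eta> where "\<eta> z k = (if k = i then c z j else 0) - (if k = j then c z i else 0)" for z k
  define a where "a z = c z i * c z j * (c z i + c z j)" for z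
  define b where "b z = 2 * (\<Sum>k\<in>UNIV. c z k * y z k * \<eta> z k)" for z
  define e where "e z = (\<Sum>k\<in>UNIV. c z k * (y z k)\<^sup>2) - S z" for z
  obtain \<zeta> where \<zeta>: "\<And>z. a z \<noteq> 0 \<Longrightarrow> a z * (\<zeta> z)\<^sup>2 + b z * \<zeta> z + e z = 0"
      "\<And>z. a z \<noteq> 0 \<Longrightarrow> (cmod (\<zeta> z))\<^sup>2 \<le> cmod (e z / a z)"
  proof -
    have "\<forall>z. \<exists>x. a z \<noteq> 0 \<longrightarrow> a z * x\<^sup>2 + b z * x + e z = 0 \<and> (cmod x)\<^sup>2 \<le> cmod (e z / a z)"
      using small_quadratic_root by blast
    from choice[OF this] show ?thesis using that by blast
  qed
  define t where "t z = (\<chi> k. y z k + \<zeta> z * \<eta> z k)" for z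
  have y_lim: "((\<lambda>z. y z k) \<longlongrightarrow> t\<^sub>0 $ k) (at 0)" for k
  proof -
    have "((\<lambda>z. - (\<Sum>k\<in>UNIV. c z k * t\<^sub>0 $ k) / c z i) \<longlongrightarrow> - (\<Sum>k\<in>UNIV. c\<^sub>0 k * t\<^sub>0 $ k) / c\<^sub>0 i) (at 0)"
      by (intro tendsto_intros c nz)
    from tendsto_add[OF tendsto_const[of "t\<^sub>0 $ k"] this] show ?thesis
      unfolding y_def t\<^sub>0(1) by (cases "k = i") simp_all
  qed
  have \<eta>_lim: "((\<lambda>z. \<eta> z k) \<longlongrightarrow> (if k = i then c\<^sub>0 j else 0) - (if k = j then c\<^sub>0 i else 0)) (at 0)" for k
    unfolding \<eta>_def by (intro tendsto_diff) (use c in auto)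
  have a_lim: "(a \<longlongrightarrow> c\<^sub>0 i * c\<^sub>0 j * (c\<^sub>0 i + c\<^sub>0 j)) (at 0)"
    unfolding a_def by (intro tendsto_intros c)
  have e_lim: "(e \<longlongrightarrow> (\<Sum>k\<in>UNIV. c\<^sub>0 k * (t\<^sub>0 $ k)\<^sup>2) - S\<^sub>0) (at 0)"
    unfolding e_def by (intro tendsto_intros c S y_lim)
  have a_ev: "\<forall>\<^sub>F z in at 0. a z \<noteq> 0"
    using tendsto_imp_eventually_ne[OF a_lim] nz by simp
  have "((\<lambda>z. e z / a z) \<longlongrightarrow> 0) (at 0)"
    using tendsto_divide[OF e_lim a_lim] nz t\<^sub>0(2) by simp
  then have "((\<lambda>z. sqrt (cmod (e z / a z))) \<longlongrightarrow> 0) (at 0)"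
    using tendsto_real_sqrt[OF tendsto_norm, of "\<lambda>z. e z / a z" 0 "at 0"] by simp
  moreover have "\<forall>\<^sub>F z in at 0. cmod (\<zeta> z) \<le> sqrt (cmod (e z / a z))"
    using a_ev by eventually_elim (use \<zeta>(2) in \<open>simp add: real_le_rsqrt\<close>)
  ultimately have \<zeta>_lim: "(\<zeta> \<longlongrightarrow> 0) (at 0)"
    by (rule Lim_null_comparison[rotated])
  have "(t \<longlongrightarrow> t\<^sub>0) (at 0)"
  proof (rule vec_tendstoI)
    fix k
    have "((\<lambda>z. y z k + \<zeta> z * \<eta> z k) \<longlongrightarrow>
        t\<^sub>0 $ k + 0 * ((if k = i then c\<^sub>0 j else 0) - (if k = j then c\<^sub>0 i else 0))) (at 0)"
      by (intro tendsto_intros y_lim \<eta>_lim \<zeta>_lim)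
    then show "((\<lambda>z. t z $ k) \<longlongrightarrow> t\<^sub>0 $ k) (at 0)" by (simp add: t_def)
  qed
  moreover have "\<forall>\<^sub>F z in at 0. c z i \<noteq> 0"
    using tendsto_imp_eventually_ne[OF c] nz by blast
  with a_ev have "\<forall>\<^sub>F z in at 0.
      (\<Sum>k\<in>UNIV. c z k * t z $ k) = 0 \<and> (\<Sum>k\<in>UNIV. c z k * (t z $ k)\<^sup>2) = S z"
  proof eventually_elim
    case (elim z)
    have sum_\<eta>: "(\<Sum>k\<in>UNIV. f k * \<eta> z k) = f i * c z j - f j * c z i" for f
    proof -
      have "f k * \<eta> z k = (if k = i then f i * c z j else 0) - (if k = j then f j * c z i else 0)" for k
        by (simp add: \<eta>_def right_diff_distrib)
      then show ?thesis by (simp add: sum_subtractf)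
    qed
    have "c z k * y z k
        = c z k * t\<^sub>0 $ k + (if k = i then - (\<Sum>k\<in>UNIV. c z k * t\<^sub>0 $ k) else 0)" for k
      using elim(2) by (simp add: y_def distrib_left)
    then have "(\<Sum>k\<in>UNIV. c z k * y z k) = 0" by (simp add: sum.distrib)
    moreover have "(\<Sum>k\<in>UNIV. c z k * t z $ k) = (\<Sum>k\<in>UNIV. c z k * y z k) + \<zeta> z * (\<Sum>k\<in>UNIV. c z k * \<eta> z k)"
      by (simp add: t_def sum.distrib sum_distrib_left algebra_simps)
    ultimately have 1: "(\<Sum>k\<in>UNIV. c z k * t z $ k) = 0" by (simp add: sum_\<eta>)
    have "(\<Sum>k\<in>UNIV. c z k * (\<eta> z k)\<^sup>2) = (\<Sum>k\<in>UNIV. (c z k * \<eta> z k) * \<eta> z k)"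
      by (simp add: power2_eq_square mult.assoc)
    also have "\<dots> = a z"
      unfolding sum_\<eta> using nz(4) by (simp add: \<eta>_def a_def algebra_simps)
    finally have "(\<Sum>k\<in>UNIV. c z k * (\<eta> z k)\<^sup>2) = a z" .
    moreover have "(\<Sum>k\<in>UNIV. c z k * (t z $ k)\<^sup>2) = (\<Sum>k\<in>UNIV. c z k * (y z k)\<^sup>2)
        + 2 * \<zeta> z * (\<Sum>k\<in>UNIV. c z k * y z k * \<eta> z k) + (\<zeta> z)\<^sup>2 * (\<Sum>k\<in>UNIV. c z k * (\<eta> z k)\<^sup>2)"
      by (simp add: t_def sum.distrib sum_distrib_left algebra_simps power2_eq_square)
    ultimately have "(\<Sum>k\<in>UNIV. c z k * (t z $ k)\<^sup>2) = e z + S z + b z * \<zeta> z + a z * (\<zeta> z)\<^sup>2"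
      by (simp add: e_def b_def)
    also have "\<dots> = S z" using \<zeta>(1)[OF elim(1)] by algebra
    finally show ?case using 1 by blast
  qed
  ultimately show ?thesis by (rule that)
qed

lemma eventually_affine_nonzero:
  fixes a b :: complex
  assumes "b \<noteq> 0"
  shows "\<forall>\<^sub>F z in at 0. a + z * b \<noteq> 0"
proof -
  have "\<forall>\<^sub>F z in at 0. z \<noteq> - a / b" by (rule eventually_neq_at_within)
  then show ?thesis
    by eventually_elim (use assms in \<open>auto simp: field_simps add_eq_0_iff2\<close>)
qed

section \<open>Points satisfying the classical relations\<close>

text \<open>The functional maps x^3 to K and x^4 to (u1 + u2 + u3 + u4) K = 0, so only the cross
  term of q x and r x^2 survives.\<close>

lemma weighted_square_sum:
  fixes c1 c2 c3 c4 u1 u2 u3 u4 p q r :: complex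
  assumes c: "c1 + c2 + c3 + c4 = 0" "c1 * u1 + c2 * u2 + c3 * u3 + c4 * u4 = 0"
    "c1 * u1\<^sup>2 + c2 * u2\<^sup>2 + c3 * u3\<^sup>2 + c4 * u4\<^sup>2 = 0"
    and u: "u1 + u2 + u3 + u4 = 0"
  shows "c1 * (p + q * u1 + r * u1\<^sup>2)\<^sup>2 + c2 * (p + q * u2 + r * u2\<^sup>2)\<^sup>2
    + c3 * (p + q * u3 + r * u3\<^sup>2)\<^sup>2 + c4 * (p + q * u4 + r * u4\<^sup>2)\<^sup>2
    = 2 * q * r * (c1 * ((u1 - u2) * (u1 - u3) * (u1 - u4)))"
proof -
  define K where "K = c1 * ((u1 - u2) * (u1 - u3) * (u1 - u4))"
  have "c1 * u1 ^ 3 + c2 * u2 ^ 3 + c3 * u3 ^ 3 + c4 * u4 ^ 3 - (u2 + u3 + u4) * (c1 * u1\<^sup>2 + c2 * u2\<^sup>2 + c3 * u3\<^sup>2 + c4 * u4\<^sup>2)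
    + (u2 * u3 + u2 * u4 + u3 * u4) * (c1 * u1 + c2 * u2 + c3 * u3 + c4 * u4)
    - u2 * u3 * u4 * (c1 + c2 + c3 + c4) = K" unfolding K_def by algebra
  then have cube: "c1 * u1 ^ 3 + c2 * u2 ^ 3 + c3 * u3 ^ 3 + c4 * u4 ^ 3 = K" unfolding c by simp
  have "c1 * u1 ^ 4 + c2 * u2 ^ 4 + c3 * u3 ^ 4 + c4 * u4 ^ 4
    - (u2 + u3 + u4) * (c1 * u1 ^ 3 + c2 * u2 ^ 3 + c3 * u3 ^ 3 + c4 * u4 ^ 3)
    + (u2 * u3 + u2 * u4 + u3 * u4) * (c1 * u1\<^sup>2 + c2 * u2\<^sup>2 + c3 * u3\<^sup>2 + c4 * u4\<^sup>2)
    - u2 * u3 * u4 * (c1 * u1 + c2 * u2 + c3 * u3 + c4 * u4) = u1 * K" unfolding K_def by algebra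
  then have "c1 * u1 ^ 4 + c2 * u2 ^ 4 + c3 * u3 ^ 4 + c4 * u4 ^ 4 = (u1 + u2 + u3 + u4) * K"
    unfolding c cube by algebra
  then have fourth: "c1 * u1 ^ 4 + c2 * u2 ^ 4 + c3 * u3 ^ 4 + c4 * u4 ^ 4 = 0" unfolding u by simp
  have "c1 * (p + q * u1 + r * u1\<^sup>2)\<^sup>2 + c2 * (p + q * u2 + r * u2\<^sup>2)\<^sup>2
    + c3 * (p + q * u3 + r * u3\<^sup>2)\<^sup>2 + c4 * (p + q * u4 + r * u4\<^sup>2)\<^sup>2
    = p\<^sup>2 * (c1 + c2 + c3 + c4) + 2 * p * q * (c1 * u1 + c2 * u2 + c3 * u3 + c4 * u4)
    + (q\<^sup>2 + 2 * p * r) * (c1 * u1\<^sup>2 + c2 * u2\<^sup>2 + c3 * u3\<^sup>2 + c4 * u4\<^sup>2)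
    + 2 * q * r * (c1 * u1 ^ 3 + c2 * u2 ^ 3 + c3 * u3 ^ 3 + c4 * u4 ^ 3)
    + r\<^sup>2 * (c1 * u1 ^ 4 + c2 * u2 ^ 4 + c3 * u3 ^ 4 + c4 * u4 ^ 4)" by algebra
  also have "\<dots> = 2 * q * r * K" unfolding c cube fourth by simp
  finally show ?thesis unfolding K_def .
qed

lemma char_curve_sum_inverse:
  fixes l :: "complex ^ 3"
  assumes "\<And>j. l $ j \<noteq> 0" "CS l"
  shows "l \<in> char_curve (\<Sum>j\<in>UNIV. 1 / l $ j) (l $ 1 * l $ 2 * l $ 3)"
  using assms(2) assms(1)[of 1] assms(1)[of 2] assms(1)[of 3]
  by (simp add: CS_def char_curve_def sum_3 field_simps)

text \<open>As (x + 1)^2 / x = x + 2 + 1 / x, (CS) makes the first two terms contribute 1 + 6 of the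
  16.\<close>

lemma BB_iff:
  fixes l :: "complex ^ 3"
  assumes "\<And>j. l $ j \<noteq> 0" "CS l"
  shows "BB t d l \<longleftrightarrow> (\<Sum>k\<in>UNIV. (t $ k)\<^sup>2 / d $ k) = 9 - (\<Sum>j\<in>UNIV. 1 / l $ j)"
proof -
  have "(x + 1)\<^sup>2 / x = x + 2 + 1 / x" if "x \<noteq> 0" for x :: complex
    using that by (simp add: field_simps power2_eq_square)
  then have "(\<Sum>j\<in>UNIV. (l $ j + 1)\<^sup>2 / l $ j) = 7 + (\<Sum>j\<in>UNIV. 1 / l $ j)"
    using assms by (simp add: sum.distrib CS_def)
  then show ?thesis unfolding BB_def by (auto simp: algebra_simps)
qed

text \<open>A normal form with finite spectrum (t, d) is reconstructed. The pair sums of 1 / d_k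
  serve \<open>exists_normalized_quadruple\<close>; inverse sums 9 and 1 would mean X = 0 and Y =
  0.\<close>

proposition relation_at_generic_point:
  fixes p q :: "8 cpoly" and pr qr :: "3 cpoly" and t d :: "complex ^ 4" and l :: "complex ^ 3"
  assumes relation: "\<And>v t d l. nondegenerate v \<Longrightarrow> extended_spectrum v t d l \<Longrightarrow>
      poly_eval q (join t d) \<noteq> 0 \<Longrightarrow> poly_eval qr l \<noteq> 0 \<Longrightarrow>
      poly_eval p (join t d) * poly_eval qr l = poly_eval q (join t d) * poly_eval pr l"
    and nz: "\<And>k. d $ k \<noteq> 0" "\<And>j. l $ j \<noteq> 0"
    and classical: "EJ1 d" "EJ2 t d" "BB t d l" "CS l"
    and gen: "1 / d $ 1 + 1 / d $ 2 \<noteq> 0" "1 / d $ 1 + 1 / d $ 3 \<noteq> 0" "1 / d $ 2 + 1 / d $ 3 \<noteq> 0"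
    and s: "(\<Sum>j\<in>UNIV. 1 / l $ j) \<notin> {1, 9}"
    and q: "poly_eval q (join t d) \<noteq> 0" and qr: "poly_eval qr l \<noteq> 0"
  shows "poly_eval p (join t d) * poly_eval qr l = poly_eval q (join t d) * poly_eval pr l"
proof -
  define s where "s = (\<Sum>j\<in>UNIV. 1 / l $ j)"
  define m where "m = l $ 1 * l $ 2 * l $ 3"
  have m: "m \<noteq> 0" "l \<in> char_curve s m"
    using nz(2) char_curve_sum_inverse[OF nz(2) \<open>CS l\<close>] by (simp_all add: m_def s_def)
  have dnz: "d $ 1 \<noteq> 0" "d $ 2 \<noteq> 0" "d $ 3 \<noteq> 0" "d $ 4 \<noteq> 0" using nz(1) by blast+
  define c1 c2 c3 c4 where c_def: "c1 = 1 / d $ 1" "c2 = 1 / d $ 2" "c3 = 1 / d $ 3" "c4 = 1 / d $ 4"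
  have cd: "d $ 1 = 1 / c1" "d $ 2 = 1 / c2" "d $ 3 = 1 / c3" "d $ 4 = 1 / c4"
    by (simp_all add: c_def)
  have cnz: "c1 \<noteq> 0" "c2 \<noteq> 0" "c3 \<noteq> 0" "c4 \<noteq> 0" using dnz by (simp_all add: c_def)
  have c0: "c1 + c2 + c3 + c4 = 0" using \<open>EJ1 d\<close> by (simp add: EJ1_def sum_4 c_def)
  have c1: "c1 * t $ 1 + c2 * t $ 2 + c3 * t $ 3 + c4 * t $ 4 = 0"
    using \<open>EJ2 t d\<close> by (simp add: EJ2_def sum_4 c_def)
  have c2: "c1 * (t $ 1)\<^sup>2 + c2 * (t $ 2)\<^sup>2 + c3 * (t $ 3)\<^sup>2 + c4 * (t $ 4)\<^sup>2 = 9 - s"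
    using \<open>BB t d l\<close> BB_iff[OF nz(2) \<open>CS l\<close>] by (simp add: sum_4 c_def s_def)
  obtain u1 u2 u3 u4 where dist: "distinct [u1, u2, u3, u4]"
    and u: "u1 + u2 + u3 + u4 = 0" "u1 * u2 * u3 + u1 * u2 * u4 + u1 * u3 * u4 + u2 * u3 * u4 = 1"
      "c1 * u1 + c2 * u2 + c3 * u3 + c4 * u4 = 0" "c1 * u1\<^sup>2 + c2 * u2\<^sup>2 + c3 * u3\<^sup>2 + c4 * u4\<^sup>2 = 0"
    using exists_normalized_quadruple[OF c0 cnz] gen unfolding c_def[symmetric] by blast
  define K where "K = c1 * ((u1 - u2) * (u1 - u3) * (u1 - u4))"
  have "K \<noteq> 0" using cnz dist by (simp add: K_def)
  have K2: "K = c2 * ((u2 - u1) * (u2 - u3) * (u2 - u4))"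
    unfolding K_def by (rule weights_times_derivative[OF c0 u(3,4)])
  have K3: "K = c3 * ((u3 - u1) * (u3 - u2) * (u3 - u4))"
    unfolding K_def using weights_times_derivative[of c1 c3 c2 c4 u1 u3 u2 u4] c0 u(3,4)
    by (simp add: ac_simps)
  have K4: "K = c4 * ((u4 - u1) * (u4 - u2) * (u4 - u3))"
    unfolding K_def using weights_times_derivative[of c1 c4 c2 c3 u1 u4 u2 u3] c0 u(3,4)
    by (simp add: ac_simps)
  obtain P Q S where t: "t $ 1 = P + Q * u1 + S * u1\<^sup>2" "t $ 2 = P + Q * u2 + S * u2\<^sup>2"
    "t $ 3 = P + Q * u3 + S * u3\<^sup>2" "t $ 4 = P + Q * u4 + S * u4\<^sup>2"
    using interpolate_quadratic[OF dist cnz(4) c0 u(3,4) c1] by blast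
  have QS: "2 * Q * S * K = 9 - s"
    using weighted_square_sum[OF c0 u(3,4,1), of P Q S] c2 unfolding t K_def by simp
  \<comment> \<open>Comparing P + Q u + S u^2 with 2\<alpha> u + 2\<delta> (u^2 - \<kappa>) -
    (\<beta> + \<gamma>) gives \<alpha>, \<delta> and, below, \<open>T\<close> as \<beta> +
    \<gamma>. Since K = f'(u_k) / d_k and d_k must be (X - Y) f'(u_k), X - Y has to be 1 /
    K.\<close>
  define \<alpha> \<delta> where "\<alpha> = Q / 2" and "\<delta> = S / 2"
  define X Y where "X = \<alpha> * \<delta>" and "Y = X - 1 / K"
  have YK: "Y * K = X * K - 1" using \<open>K \<noteq> 0\<close> by (simp add: Y_def left_diff_distrib)
  have X8: "8 * (X * K) = 9 - s" using QS by (simp add: X_def \<alpha>_def \<delta>_def ac_simps)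
  have "8 * (Y * K) = 1 - s" using X8 unfolding YK by (simp add: right_diff_distrib)
  note XK = X8 this
  have products: "X \<noteq> 0" "Y \<noteq> 0" "X \<noteq> Y" "X - Y = 1 / K"
  proof -
    show "X \<noteq> 0" using XK(1) s unfolding s_def[symmetric] by auto
    show "Y \<noteq> 0" using XK(2) s unfolding s_def[symmetric] by auto
    show "X \<noteq> Y" "X - Y = 1 / K" using \<open>K \<noteq> 0\<close> by (simp_all add: Y_def)
  qed
  have "8 * K * (X - 9 * Y) = 8 * K * (s * (X - Y))" using XK by algebra
  then have sXY: "X - 9 * Y = s * (X - Y)" using \<open>K \<noteq> 0\<close> by simp
  have nz\<alpha>: "\<alpha> \<noteq> 0" using products(1) by (auto simp: X_def)
  define u :: "complex ^ 4" where "u = vector [u1, u2, u3, u4]"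
  have uk: "u $ 1 = u1" "u $ 2 = u2" "u $ 3 = u3" "u $ 4 = u4"
    by (simp_all add: u_def vector_def)
  have "inj (($) u)"
    using dist by (auto simp: inj_def forall_4 uk)
  then interpret spectrum_relation p q pr qr u X Y s
    using relation u(1,2) products sXY by unfold_locales (simp_all add: uk)
  have \<kappa>: "2 * \<kappa> = - (u1 * u2 + u1 * u3 + u1 * u4 + u2 * u3 + u2 * u4 + u3 * u4)"
    by (simp add: \<kappa>_def uk)
  define T where "T = - (P + 2 * \<delta> * \<kappa>)"
  obtain \<beta> where \<beta>: "\<beta> \<noteq> 0" "\<beta> + Y / \<beta> = T"
  proof -
    obtain \<beta> where "1 * \<beta>\<^sup>2 + (- T) * \<beta> + Y = 0" using small_quadratic_root[of 1 "- T" Y] by auto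
    moreover from this have "\<beta> \<noteq> 0" using products(2) by auto
    ultimately show ?thesis by (intro that[of \<beta>]) (simp_all add: field_simps power2_eq_square)
  qed
  have "traces \<alpha> \<beta> = t"
  proof -
    have "X / \<alpha> = \<delta>" using nz\<alpha> by (simp add: X_def)
    then have "traces \<alpha> \<beta> $ k = P + Q * u $ k + S * (u $ k)\<^sup>2" for k
      unfolding traces_def vec_lambda_beta \<beta>(2) by (simp add: T_def \<alpha>_def \<delta>_def algebra_simps)
    then show ?thesis by (simp add: vec_eq_iff forall_4 t uk)
  qed
  moreover have "dets = d"
  proof -
    have deriv: "(u1 - u2) * (u1 - u3) * (u1 - u4) = 4 * u1 * (u1\<^sup>2 - \<kappa>) - 1"
      "(u2 - u1) * (u2 - u3) * (u2 - u4) = 4 * u2 * (u2\<^sup>2 - \<kappa>) - 1"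
      "(u3 - u1) * (u3 - u2) * (u3 - u4) = 4 * u3 * (u3\<^sup>2 - \<kappa>) - 1"
      "(u4 - u1) * (u4 - u2) * (u4 - u3) = 4 * u4 * (u4\<^sup>2 - \<kappa>) - 1"
      using u(1,2) \<kappa> by algebra+
    have quotient: "1 / K * x = 1 / c" if "K = c * x" for c x
    proof -
      have "x \<noteq> 0" using that \<open>K \<noteq> 0\<close> by auto
      then show ?thesis unfolding that by simp
    qed
    show ?thesis
      unfolding vec_eq_iff forall_4 dets_def vec_lambda_beta products(4) uk cd
      by (intro conjI quotient; fact K_def[unfolded deriv] K2[unfolded deriv] K3[unfolded deriv]
          K4[unfolded deriv])
  qed
  ultimately show ?thesis
    using relation_on_char_curve[OF nz\<alpha> \<beta>(1) _ m(2,1) qr] q by simp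
qed

text \<open>The direction (1, 1, -2) preserves (CS). After clearing denominators the coefficient of
  z^3 is 2\<sigma>, so equality holds at finitely many z only.\<close>

lemma sum_inverse_deformation:
  fixes l\<^sub>1 l\<^sub>2 l\<^sub>3 \<sigma> :: complex
  assumes "\<sigma> \<noteq> 0"
  shows "\<forall>\<^sub>F z in at 0. 1 / (l\<^sub>1 + z) + 1 / (l\<^sub>2 + z) + 1 / (l\<^sub>3 - 2 * z) \<noteq> \<sigma>"
proof -
  define P where "P = [:l\<^sub>2, 1:] * [:l\<^sub>3, - 2:] + [:l\<^sub>1, 1:] * [:l\<^sub>3, - 2:] + [:l\<^sub>1, 1:] * [:l\<^sub>2, 1:]
    - smult \<sigma> ([:l\<^sub>1, 1:] * [:l\<^sub>2, 1:] * [:l\<^sub>3, - 2:])"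
  have "coeff P 3 = 2 * \<sigma>" by (simp add: P_def numeral_3_eq_3)
  then have "P \<noteq> 0" using assms by auto
  then obtain a where "poly P a \<noteq> 0" using poly_all_0_iff_0 by blast
  then have "\<forall>\<^sub>F z in at 0. poly P z \<noteq> 0"
    by (intro entire_eventually_nonzero) (auto intro!: holomorphic_intros)
  moreover have "\<forall>\<^sub>F z in at 0. l\<^sub>1 + z * 1 \<noteq> 0" "\<forall>\<^sub>F z in at 0. l\<^sub>2 + z * 1 \<noteq> 0"
    "\<forall>\<^sub>F z in at 0. l\<^sub>3 + z * (- 2) \<noteq> 0"
    by (intro eventually_affine_nonzero; simp)+
  ultimately show ?thesis
  proof eventually_elim
    case (elim z)
    have nz: "l\<^sub>1 + z \<noteq> 0" "l\<^sub>2 + z \<noteq> 0" "l\<^sub>3 - 2 * z \<noteq> 0" using elim(2-4) by (simp_all add: mult.commute)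
    have "poly P z = (l\<^sub>2 + z) * (l\<^sub>3 - 2 * z) + (l\<^sub>1 + z) * (l\<^sub>3 - 2 * z) + (l\<^sub>1 + z) * (l\<^sub>2 + z)
      - \<sigma> * ((l\<^sub>1 + z) * (l\<^sub>2 + z) * (l\<^sub>3 - 2 * z))"
      unfolding P_def poly_diff poly_add poly_mult poly_smult
      by (simp only: poly_pCons poly_0) algebra
    also have "\<dots> = (1 / (l\<^sub>1 + z) + 1 / (l\<^sub>2 + z) + 1 / (l\<^sub>3 - 2 * z) - \<sigma>)
        * ((l\<^sub>1 + z) * (l\<^sub>2 + z) * (l\<^sub>3 - 2 * z))"
    proof -
      have "y * w + x * w + x * y - \<sigma> * (x * y * w) = (1 / x + 1 / y + 1 / w - \<sigma>) * (x * y * w)"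
        if "x \<noteq> 0" "y \<noteq> 0" "w \<noteq> 0" for x y w
        using that by (simp add: field_simps)
      from this[OF nz] show ?thesis .
    qed
    finally show ?case using elim(1) by auto
  qed
qed

proposition relation_at_classical_point:
  fixes p q :: "8 cpoly" and pr qr :: "3 cpoly" and t d :: "complex ^ 4" and l :: "complex ^ 3"
  assumes relation: "\<And>v t d l. nondegenerate v \<Longrightarrow> extended_spectrum v t d l \<Longrightarrow>
      poly_eval q (join t d) \<noteq> 0 \<Longrightarrow> poly_eval qr l \<noteq> 0 \<Longrightarrow>
      poly_eval p (join t d) * poly_eval qr l = poly_eval q (join t d) * poly_eval pr l"
    and nz: "\<And>k. d $ k \<noteq> 0" "\<And>j. l $ j \<noteq> 0"
    and classical: "EJ1 d" "EJ2 t d" "BB t d l" "CS l"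
    and q: "poly_eval q (join t d) \<noteq> 0" and qr: "poly_eval qr l \<noteq> 0"
  shows "poly_eval p (join t d) * poly_eval qr l = poly_eval q (join t d) * poly_eval pr l"
proof -
  \<comment> \<open>A direction for 1 / d_k: sum 0 preserves (EJ1), and the pair sums 3, 5, 6 of the
    first three entries make the pair sums of the deformed weights nonzero.\<close>
  define h :: "complex ^ 4" where "h = vector [1, 2, 4, - 7]"
  have h: "h $ 1 = 1" "h $ 2 = 2" "h $ 3 = 4" "h $ 4 = - 7" by (simp_all add: h_def vector_def)
  define c where "c z k = 1 / d $ k + z * h $ k" for z k
  define D where "D z = (\<chi> k. 1 / c z k)" for z
  define L where "L z = (vector [l $ 1 + z, l $ 2 + z, l $ 3 - 2 * z] :: complex ^ 3)" for z
  define S where "S z = 9 - (\<Sum>j\<in>UNIV. 1 / L z $ j)" for z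
  have c_lim: "((\<lambda>z. c z k) \<longlongrightarrow> 1 / d $ k) (at 0)" for k
    unfolding c_def by (auto intro!: tendsto_eq_intros)
  have L_lim: "(L \<longlongrightarrow> l) (at 0)"
  proof (rule vec_tendstoI)
    have "\<forall>j. ((\<lambda>z. L z $ j) \<longlongrightarrow> l $ j) (at 0)"
      unfolding L_def forall_3 vector_3 by (auto intro!: tendsto_eq_intros)
    then show "((\<lambda>z. L z $ j) \<longlongrightarrow> l $ j) (at 0)" for j by blast
  qed
  have D_lim: "(D \<longlongrightarrow> d) (at 0)"
  proof (rule vec_tendstoI)
    fix k
    have "((\<lambda>z. 1 / c z k) \<longlongrightarrow> 1 / (1 / d $ k)) (at 0)"
      using nz(1) by (intro tendsto_intros c_lim) simp
    then show "((\<lambda>z. D z $ k) \<longlongrightarrow> d $ k) (at 0)" by (simp add: D_def)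
  qed
  have S_lim: "(S \<longlongrightarrow> 9 - (\<Sum>j\<in>UNIV. 1 / l $ j)) (at 0)"
    unfolding S_def using nz(2) by (intro tendsto_intros tendsto_vec_nth L_lim)
  \<comment> \<open>If all three pair sums among the first three weights vanished, so would 2 /
    d_1.\<close>
  obtain i j where ij: "1 / d $ i + 1 / d $ j \<noteq> 0" "i \<noteq> j"
  proof -
    have "1 / d $ 1 \<noteq> 0" using nz(1) by simp
    moreover have "1 / d $ 1 + 1 / d $ 2 + (1 / d $ 1 + 1 / d $ 3) - (1 / d $ 2 + 1 / d $ 3) = 2 * (1 / d $ 1)"
      by simp
    ultimately have "1 / d $ 1 + 1 / d $ 2 \<noteq> 0 \<or> 1 / d $ 1 + 1 / d $ 3 \<noteq> 0 \<or> 1 / d $ 2 + 1 / d $ 3 \<noteq> 0"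
      by (metis add.right_neutral diff_zero mult_eq_0_iff zero_neq_numeral)
    then show ?thesis using that[of 1 2] that[of 1 3] that[of 2 3] by auto
  qed
  have sum_1: "(\<Sum>k\<in>UNIV. 1 / d $ k * t $ k) = 0"
    using \<open>EJ2 t d\<close> by (simp add: EJ2_def)
  have sum_2: "(\<Sum>k\<in>UNIV. 1 / d $ k * (t $ k)\<^sup>2) = 9 - (\<Sum>j\<in>UNIV. 1 / l $ j)"
    using \<open>BB t d l\<close> BB_iff[OF nz(2) \<open>CS l\<close>] by simp
  have ij_nz: "1 / d $ i \<noteq> 0" "1 / d $ j \<noteq> 0" using nz(1) by simp_all
  obtain T where T_lim: "(T \<longlongrightarrow> t) (at 0)"
    and T: "\<forall>\<^sub>F z in at 0. (\<Sum>k\<in>UNIV. c z k * T z $ k) = 0 \<and> (\<Sum>k\<in>UNIV. c z k * (T z $ k)\<^sup>2) = S z"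
    by (rule deform_traces[OF c_lim S_lim ij_nz ij sum_1 sum_2])
  have lim: "((\<lambda>z. poly_eval f (join (T z) (D z))) \<longlongrightarrow> poly_eval f (join t d)) (at 0)"
    "((\<lambda>z. poly_eval g (L z)) \<longlongrightarrow> poly_eval g l) (at 0)" for f g
    by (intro tendsto_intros T_lim D_lim L_lim)+
  have c_nz: "\<forall>\<^sub>F z in at 0. c z k \<noteq> 0" for k
    using tendsto_imp_eventually_ne[OF c_lim] nz(1) by simp
  have L_nz: "\<forall>\<^sub>F z in at 0. L z $ k \<noteq> 0" for k
    using tendsto_imp_eventually_ne[OF tendsto_vec_nth[OF L_lim]] nz(2) by simp
  have c_gen: "\<forall>\<^sub>F z in at 0. c z k + c z k' \<noteq> 0" if "h $ k + h $ k' \<noteq> 0" for k k'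
    using eventually_affine_nonzero[OF that, of "1 / d $ k + 1 / d $ k'"]
    by eventually_elim (simp add: c_def algebra_simps)
  have L_gen: "\<forall>\<^sub>F z in at 0. (\<Sum>j\<in>UNIV. 1 / L z $ j) \<noteq> \<sigma>" if "\<sigma> \<noteq> 0" for \<sigma>
    using sum_inverse_deformation[OF that] by (simp add: sum_3 L_def)
  have "\<forall>\<^sub>F z in at 0. \<forall>k\<in>UNIV. c z k \<noteq> 0" "\<forall>\<^sub>F z in at 0. \<forall>k\<in>UNIV. L z $ k \<noteq> 0"
    by (intro eventually_ball_finite ballI finite c_nz L_nz)+
  moreover have "\<forall>\<^sub>F z in at 0. poly_eval q (join (T z) (D z)) \<noteq> 0" "\<forall>\<^sub>F z in at 0. poly_eval qr (L z) \<noteq> 0"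
    using tendsto_imp_eventually_ne[OF lim(1) q] tendsto_imp_eventually_ne[OF lim(2) qr] by blast+
  moreover have "\<forall>\<^sub>F z in at 0. c z 1 + c z 2 \<noteq> 0" "\<forall>\<^sub>F z in at 0. c z 1 + c z 3 \<noteq> 0"
    "\<forall>\<^sub>F z in at 0. c z 2 + c z 3 \<noteq> 0"
    by (intro c_gen; simp add: h)+
  moreover have "\<forall>\<^sub>F z in at 0. (\<Sum>j\<in>UNIV. 1 / L z $ j) \<noteq> 1" "\<forall>\<^sub>F z in at 0. (\<Sum>j\<in>UNIV. 1 / L z $ j) \<noteq> 9"
    by (intro L_gen; simp)+
  ultimately have "\<forall>\<^sub>F z in at 0. poly_eval p (join (T z) (D z)) * poly_eval qr (L z)
      = poly_eval q (join (T z) (D z)) * poly_eval pr (L z)"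
    using T
  proof eventually_elim
    case (elim z)
    have Dc: "1 / D z $ k = c z k" "x / D z $ k = c z k * x" "D z $ k \<noteq> 0" for k x
      using elim(1) by (simp_all add: D_def)
    have LCS: "CS (L z)" using \<open>CS l\<close> by (simp add: CS_def L_def sum_3 algebra_simps)
    have Lnz: "\<And>j. L z $ j \<noteq> 0" using elim(2) by blast
    show ?case
    proof (rule relation_at_generic_point[OF relation])
      show "EJ1 (D z)"
        using \<open>EJ1 d\<close> by (simp add: EJ1_def Dc) (simp add: c_def sum.distrib sum_4 h algebra_simps)
      show "EJ2 (T z) (D z)" using elim(10) by (simp add: EJ2_def Dc)
      show "BB (T z) (D z) (L z)"
        unfolding BB_iff[OF Lnz LCS] using elim(10) by (simp add: Dc S_def)
    qed (use elim LCS Dc in auto)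
  qed
  then have "((\<lambda>z. poly_eval p (join (T z) (D z)) * poly_eval qr (L z)
      - poly_eval q (join (T z) (D z)) * poly_eval pr (L z)) \<longlongrightarrow> 0) (at 0)"
    by (intro tendsto_eventually) (auto elim: eventually_mono)
  moreover have "((\<lambda>z. poly_eval p (join (T z) (D z)) * poly_eval qr (L z)
      - poly_eval q (join (T z) (D z)) * poly_eval pr (L z)) \<longlongrightarrow>
      poly_eval p (join t d) * poly_eval qr l - poly_eval q (join t d) * poly_eval pr l) (at 0)"
    by (intro tendsto_intros lim)
  ultimately have "poly_eval p (join t d) * poly_eval qr l - poly_eval q (join t d) * poly_eval pr l = 0"
    by (rule LIM_unique[rotated])
  then show ?thesis by simp
qed

theorem theorem1p4:
  fixes R :: "8 ratfun" and r :: "3 ratfun"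
  assumes "symmetric_ratfun r"
    and "\<And>v t d l. nondegenerate v \<Longrightarrow> extended_spectrum v t d l \<Longrightarrow> relation_at R r t d l"
  shows "derivable_from_classical R r"
  unfolding derivable_from_classical_def relation_at_def
proof (intro allI impI)
  fix t d :: "complex ^ 4" and l :: "complex ^ 3"
  assume nz: "\<forall>k. d $ k \<noteq> 0" "\<forall>j. l $ j \<noteq> 0"
    and classical: "EJ1 d" "EJ2 t d" "BB t d l" "CS l"
    and "ratfun_defined R (join t d)" "ratfun_defined r l"
  then obtain p q pr qr where R: "R = Fract p q" "poly_eval q (join t d) \<noteq> 0"
    and r: "r = Fract pr qr" "poly_eval qr l \<noteq> 0"
    unfolding ratfun_defined_def by blast
  have "poly_eval p (join t' d') * poly_eval qr l' = poly_eval q (join t' d') * poly_eval pr l'"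
    if "nondegenerate v" "extended_spectrum v t' d' l'" "poly_eval q (join t' d') \<noteq> 0" "poly_eval qr l' \<noteq> 0"
    for v t' d' l'
  proof -
    have "ratfun_value R (join t' d') = ratfun_value r l'"
      using assms(2)[OF that(1,2)] that(3,4) R(1) r(1)
      unfolding relation_at_def ratfun_defined_def by blast
    then show ?thesis
      using that(3,4) unfolding R(1) r(1) by (simp add: ratfun_value_Fract frac_eq_eq mult.commute)
  qed
  then have "poly_eval p (join t d) * poly_eval qr l = poly_eval q (join t d) * poly_eval pr l"
    by (rule relation_at_classical_point) (use nz classical R r in auto)
  then show "ratfun_value R (join t d) = ratfun_value r l"
    using R(2) r(2) unfolding R(1) r(1) by (simp add: ratfun_value_Fract frac_eq_eq mult.commute)
qed

end
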